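(* Let $X$ be an abelian $(n,r,c)$-drackn with eigenvalues $n-1,\theta,-1,\tau$, let $m_\theta,m_\tau$ be the multiplicities of $\theta,\tau$, and put $\delta=n-rc-2$, $\overline{m_\theta}=m_\theta/(r-1)$, $\overline{m_\tau}=m_\tau/(r-1)$. (I) Suppose $r$ is even. Then $X$ gives a set of real equiangular lines meeting the absolute bound if and only if, for some positive integer $t$ or for $t=\sqrt5$, one of the following two cases holds. Case (I.a): $n=\frac12(t^2-2)(t^2-1)$, $rc=\frac12(t+1)^3(t-2)$, $\delta=-\frac12t(t^2-5)$, $\theta=t$, $\tau=-\frac12t(t^2-3)$, $\overline{m_\theta}=\frac12(t^2-2)(t^2-3)$, $\overline{m_\tau}=t^2-2$. Case (I.b): $n=\frac12(t^2-2)(t^2-1)$, $rc=\frac12(t-1)^3(t+2)$, $\delta=\frac12t(t^2-5)$, $\theta=\frac12t(t^2-3)$, $\tau=-t$, $\overline{m_\theta}=t^2-2$, $\overline{m_\tau}=\frac12(t^2-2)(t^2-3)$. (II) Suppose $r$ is odd. Then $X$ gives a set of complex equiangular lines meeting the absolute bound if and only if, for some positive integer $t$, one of the following two cases holds. Case (II.a): $n=(t^2-1)^2$, $rc=(t+1)^2(t^2-t-1)$, $\delta=-(t^2-3)t$, $\theta=t$, $\tau=-(t^2-2)t$, $\overline{m_\theta}=(t^2-2)(t^2-1)$, $\overline{m_\tau}=t^2-1$. Case (II.b): $n=(t^2-1)^2$, $rc=(t-1)^2(t^2+t-1)$, $\delta=(t^2-3)t$, $\theta=(t^2-2)t$, $\tau=-t$,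 $\overline{m_\theta}=t^2-1$, $\overline{m_\tau}=(t^2-2)(t^2-1)$.
   Context: An $r$-fold cover of $K_n$ is a simple graph on $rn$ vertices whose vertex set is partitioned into $n$ sets of size $r$ (fibres) such that no two vertices in the same fibre are adjacent and the edges between any two distinct fibres form a perfect matching. An $(n,r,c)$-drackn (distance-regular antipodal cover of $K_n$; $n,r\ge 2$, $c\ge 1$) is an $r$-fold cover of $K_n$ that is an antipodal distance-regular graph of diameter $3$ whose antipodal classes are the fibres, in which any two vertices at distance two have exactly $c$ common neighbours. Its distinct eigenvalues are $n-1$ (multiplicity $1$), $-1$ (multiplicity $n-1$), and $\theta=\frac{\delta+\sqrt{\delta^2+4(n-1)}}{2}>0$, $\tau=\frac{\delta-\sqrt{\delta^2+4(n-1)}}{2}<0$ with $\delta=n-rc-2$. An arc function of index $r$ over $K_n$ is a function $f$ from the arcs (ordered pairs of distinct vertices) of $K_n$ to $\mathrm{Sym}(r)$ with $f(v,u)=f(u,v)^{-1}$; it determines the $r$-fold cover with vertices $(u,i)$, in which the matching from fibre $u$ to fibre $v$ is given by $f(u,v)$. It is normalized if it is the identity on the arcs of some spanning tree of $K_n$. $\langle f\rangle$ is the permutation group generated by the values of $f$. A cover determined by a normalized arc function $f$ is abelian if $\langle f\rangle$ is abelian and acts regularly on the $r$ points. Lines given by $X$: for a non-trivial linear character $\phi$ of $\langle f\rangle$, let $S$ be the $n\times n$ Hermitian matrix with zero diagonal and $(u,v)$ entry $\phi(f(u,v))$. It has exactly the two eigenvalues $\theta,\tau$, with multiplicities $\overline{m_\theta},\overline{m_\tau}$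 (so $\overline{m_\theta}+\overline{m_\tau}=n$). Then $I-\frac1\theta S$ is the Gram matrix of unit vectors spanning $n$ equiangular lines in dimension $d=\overline{m_\tau}$, and $I-\frac1\tau S$ is the Gram matrix of unit vectors spanning $n$ equiangular lines in dimension $d=\overline{m_\theta}$; these are the sets of equiangular lines given by $X$. If $r$ is even, $\phi$ can be taken real-valued and the resulting lines are real. A set of $n$ equiangular lines in dimension $d$ meets the absolute bound if $n=\binom{d+1}{2}$ in the real case, and $n=d^2$ in the complex case. Thus "$X$ gives a set of real (resp. complex) equiangular lines meeting the absolute bound" means that this equality holds for $d=\overline{m_\tau}$ or for $d=\overline{m_\theta}$. *)

theory Defs
  imports "HOL-Analysis.Analysis" "HOL-Algebra.Sym_Groups" "HOL-Algebra.Generated_Groups"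
begin

section \<open>Distance-regular graphs\<close>

text \<open>A simple graph on the finite vertex type \<open>'v\<close> is given by its adjacency relation.\<close>

definition simple_graph :: "('v \<Rightarrow> 'v \<Rightarrow> bool) \<Rightarrow> bool" where
  "simple_graph E \<longleftrightarrow> symp E \<and> irreflp E"

definition connected_graph :: "('v \<Rightarrow> 'v \<Rightarrow> bool) \<Rightarrow> bool" where
  "connected_graph E \<longleftrightarrow> (\<forall>x y. E\<^sup>*\<^sup>* x y)"

text \<open>Only meaningful when \<open>y\<close> is reachable from \<open>x\<close>; it is used for connected graphs only.\<close>

definition gdist :: "('v \<Rightarrow> 'v \<Rightarrow> bool) \<Rightarrow> 'v \<Rightarrow> 'v \<Rightarrow> nat" where
  "gdist E x y = (LEAST k. (E ^^ k) x y)"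

definition distance_regular :: "('v::finite \<Rightarrow> 'v \<Rightarrow> bool) \<Rightarrow> bool" where
  "distance_regular E \<longleftrightarrow>
     simple_graph E \<and> connected_graph E \<and>
     (\<exists>b c :: nat \<Rightarrow> nat. \<forall>x y.
        card {z. E y z \<and> gdist E x z = gdist E x y + 1} = b (gdist E x y) \<and>
        card {z. E y z \<and> gdist E x z + 1 = gdist E x y} = c (gdist E x y))"

definition diameter_graph :: "('v::finite \<Rightarrow> 'v \<Rightarrow> bool) \<Rightarrow> nat" where
  "diameter_graph E = Max {gdist E x y | x y. True}"


section \<open>Covers of complete graphs and drackns\<close>

text \<open>The complete graph \<open>K_n\<close> has vertex type \<open>'n\<close>, and the partition of the vertex set into
  fibres is given by the covering map \<open>p\<close>: the fibre of \<open>u\<close> is \<open>{x. p x = u}\<close>.\<close>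

definition cover_of_complete ::
  "('v::finite \<Rightarrow> 'v \<Rightarrow> bool) \<Rightarrow> ('v \<Rightarrow> 'n::finite) \<Rightarrow> nat \<Rightarrow> bool" where
  "cover_of_complete E p r \<longleftrightarrow>
     simple_graph E \<and>
     (\<forall>u. card {x. p x = u} = r) \<and>
     (\<forall>x y. p x = p y \<longrightarrow> \<not> E x y) \<and>
     (\<forall>x v. v \<noteq> p x \<longrightarrow> (\<exists>!y. p y = v \<and> E x y))"

definition drackn ::
  "nat \<Rightarrow> nat \<Rightarrow> nat \<Rightarrow> ('v::finite \<Rightarrow> 'v \<Rightarrow> bool) \<Rightarrow> ('v \<Rightarrow> 'n::finite) \<Rightarrow> bool" where
  "drackn n r c E p \<longleftrightarrow>
     CARD('n) = n \<and> n \<ge> 2 \<and> r \<ge> 2 \<and> c \<ge> 1 \<and>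
     cover_of_complete E p r \<and>
     distance_regular E \<and> diameter_graph E = 3 \<and>
     (\<forall>x y. gdist E x y \<in> {0, 3} \<longleftrightarrow> p x = p y) \<and>
     (\<forall>x y. gdist E x y = 2 \<longrightarrow> card {z. E x z \<and> E z y} = c)"

definition drackn_delta :: "nat \<Rightarrow> nat \<Rightarrow> nat \<Rightarrow> real" where
  "drackn_delta n r c = real n - real r * real c - 2"

definition drackn_theta :: "nat \<Rightarrow> nat \<Rightarrow> nat \<Rightarrow> real" where
  "drackn_theta n r c =
     (drackn_delta n r c + sqrt ((drackn_delta n r c)\<^sup>2 + 4 * (real n - 1))) / 2"

definition drackn_tau :: "nat \<Rightarrow> nat \<Rightarrow> nat \<Rightarrow> real" where
  "drackn_tau n r c =
     (drackn_delta n r c - sqrt ((drackn_delta n r c)\<^sup>2 + 4 * (real n - 1))) / 2"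

definition adjacency_matrix :: "('v::finite \<Rightarrow> 'v \<Rightarrow> bool) \<Rightarrow> real^'v^'v" where
  "adjacency_matrix E = (\<chi> x y. of_bool (E x y))"

text \<open>The adjacency matrix is symmetric, so the multiplicity of an eigenvalue is the dimension of
  its eigenspace.\<close>

definition eigenvalue_multiplicity :: "('v::finite \<Rightarrow> 'v \<Rightarrow> bool) \<Rightarrow> real \<Rightarrow> nat" where
  "eigenvalue_multiplicity E l = dim {x :: real^'v. adjacency_matrix E *v x = l *\<^sub>R x}"


section \<open>Arc functions and abelian covers\<close>

text \<open>\<open>Sym(r)\<close> is the library group \<open>sym_group r\<close> of permutations of \<open>{1..r}\<close>. Only the values of an
  arc function at pairs of distinct vertices matter.\<close>

definition arc_function :: "nat \<Rightarrow> ('n::finite \<Rightarrow> 'n \<Rightarrow> nat \<Rightarrow> nat) \<Rightarrow> bool" where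
  "arc_function r f \<longleftrightarrow>
     (\<forall>u v. u \<noteq> v \<longrightarrow> f u v \<in> carrier (sym_group r) \<and> f v u = inv\<^bsub>sym_group r\<^esub> (f u v))"

definition spanning_tree :: "('n::finite \<Rightarrow> 'n \<Rightarrow> bool) \<Rightarrow> bool" where
  "spanning_tree T \<longleftrightarrow>
     simple_graph T \<and> connected_graph T \<and>
     \<not> (\<exists>xs. length xs \<ge> 3 \<and> distinct xs \<and> successively T xs \<and> T (last xs) (hd xs))"

definition normalized_arc_function :: "nat \<Rightarrow> ('n::finite \<Rightarrow> 'n \<Rightarrow> nat \<Rightarrow> nat) \<Rightarrow> bool" where
  "normalized_arc_function r f \<longleftrightarrow>
     arc_function r f \<and> (\<exists>T. spanning_tree T \<and> (\<forall>u v. T u v \<longrightarrow> f u v = id))"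

definition arc_group :: "nat \<Rightarrow> ('n::finite \<Rightarrow> 'n \<Rightarrow> nat \<Rightarrow> nat) \<Rightarrow> (nat \<Rightarrow> nat) monoid" where
  "arc_group r f =
     (sym_group r)\<lparr>carrier := generate (sym_group r) {f u v | u v. u \<noteq> v}\<rparr>"

text \<open>The labelling \<open>lab\<close> identifies the vertex \<open>x\<close> with the pair \<open>(p x, lab x)\<close>, under which the
  graph becomes the cover determined by \<open>f\<close>.\<close>

definition determined_by ::
  "('v::finite \<Rightarrow> 'v \<Rightarrow> bool) \<Rightarrow> ('v \<Rightarrow> 'n::finite) \<Rightarrow> nat \<Rightarrow> ('n \<Rightarrow> 'n \<Rightarrow> nat \<Rightarrow> nat) \<Rightarrow> bool" where
  "determined_by E p r f \<longleftrightarrow>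
     (\<exists>lab :: 'v \<Rightarrow> nat.
        (\<forall>u. bij_betw lab {x. p x = u} {1..r}) \<and>
        (\<forall>x y. E x y \<longleftrightarrow> p x \<noteq> p y \<and> lab y = f (p x) (p y) (lab x)))"

definition abelian_presentation ::
  "('v::finite \<Rightarrow> 'v \<Rightarrow> bool) \<Rightarrow> ('v \<Rightarrow> 'n::finite) \<Rightarrow> nat \<Rightarrow> ('n \<Rightarrow> 'n \<Rightarrow> nat \<Rightarrow> nat) \<Rightarrow> bool" where
  "abelian_presentation E p r f \<longleftrightarrow>
     normalized_arc_function r f \<and> determined_by E p r f \<and>
     comm_group (arc_group r f) \<and>
     (\<forall>i\<in>{1..r}. \<forall>j\<in>{1..r}. \<exists>!g. g \<in> carrier (arc_group r f) \<and> g i = j)"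

definition abelian_drackn ::
  "nat \<Rightarrow> nat \<Rightarrow> nat \<Rightarrow> ('v::finite \<Rightarrow> 'v \<Rightarrow> bool) \<Rightarrow> ('v \<Rightarrow> 'n::finite) \<Rightarrow> bool" where
  "abelian_drackn n r c E p \<longleftrightarrow> drackn n r c E p \<and> (\<exists>f. abelian_presentation E p r f)"


section \<open>Equiangular lines given by an abelian drackn\<close>

definition linear_character :: "('g, 'm) monoid_scheme \<Rightarrow> ('g \<Rightarrow> complex) \<Rightarrow> bool" where
  "linear_character G \<phi> \<longleftrightarrow>
     \<phi> \<in> hom G \<lparr>carrier = UNIV - {0}, mult = (*), one = 1\<rparr>"

definition nontrivial_character :: "('g, 'm) monoid_scheme \<Rightarrow> ('g \<Rightarrow> complex) \<Rightarrow> bool" where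
  "nontrivial_character G \<phi> \<longleftrightarrow> linear_character G \<phi> \<and> (\<exists>g\<in>carrier G. \<phi> g \<noteq> 1)"

definition character_matrix ::
  "('n::finite \<Rightarrow> 'n \<Rightarrow> nat \<Rightarrow> nat) \<Rightarrow> ((nat \<Rightarrow> nat) \<Rightarrow> complex) \<Rightarrow> complex^'n^'n" where
  "character_matrix f \<phi> = (\<chi> u v. if u = v then 0 else \<phi> (f u v))"

definition cinner :: "complex^'k \<Rightarrow> complex^'k \<Rightarrow> complex" where
  "cinner x y = (\<Sum>i\<in>UNIV. x $ i * cnj (y $ i))"

text \<open>A family of unit vectors indexed by \<open>'n\<close> spanning pairwise distinct equiangular lines.\<close>

definition real_equiangular :: "('n::finite \<Rightarrow> real^'k::finite) \<Rightarrow> bool" where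
  "real_equiangular x \<longleftrightarrow>
     (\<forall>u. x u \<bullet> x u = 1) \<and> (\<exists>\<alpha><1. \<forall>u v. u \<noteq> v \<longrightarrow> \<bar>x u \<bullet> x v\<bar> = \<alpha>)"

definition complex_equiangular :: "('n::finite \<Rightarrow> complex^'k::finite) \<Rightarrow> bool" where
  "complex_equiangular x \<longleftrightarrow>
     (\<forall>u. cinner (x u) (x u) = 1) \<and> (\<exists>\<alpha><1. \<forall>u v. u \<noteq> v \<longrightarrow> cmod (cinner (x u) (x v)) = \<alpha>)"

text \<open>The dimension of a set of lines is that of the subspace spanned by them; the space in which
  they are embedded is irrelevant.\<close>

definition meets_real_absolute_bound :: "('n::finite \<Rightarrow> real^'k::finite) \<Rightarrow> bool" where
  "meets_real_absolute_bound x \<longleftrightarrow>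
     real_equiangular x \<and> CARD('n) = (dim (range x) + 1) choose 2"

text \<open>Here \<open>vec.dim\<close> is the dimension over the complex numbers.\<close>

definition meets_complex_absolute_bound :: "('n::finite \<Rightarrow> complex^'k::finite) \<Rightarrow> bool" where
  "meets_complex_absolute_bound x \<longleftrightarrow>
     complex_equiangular x \<and> CARD('n) = (vec.dim (range x))\<^sup>2"

text \<open>The two sets of lines attached to a character are those with Gram matrices
  \<open>I - (1/\<theta>) S\<close> and \<open>I - (1/\<tau>) S\<close>. A Gram matrix determines vectors up to isometry, and \<open>n\<close> vectors
  span a space of dimension at most \<open>n\<close>, so all realizations can be taken in the space of
  dimension \<open>n\<close>.\<close>

definition gives_real_lines_meeting_absolute_bound ::
  "nat \<Rightarrow> nat \<Rightarrow> nat \<Rightarrow> ('v::finite \<Rightarrow> 'v \<Rightarrow> bool) \<Rightarrow> ('v \<Rightarrow> 'n::finite) \<Rightarrow> bool" where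
  "gives_real_lines_meeting_absolute_bound n r c E p \<longleftrightarrow>
     (\<exists>f \<phi> \<eta>. \<exists>x :: 'n \<Rightarrow> real^'n.
        abelian_presentation E p r f \<and>
        nontrivial_character (arc_group r f) \<phi> \<and> \<phi> ` carrier (arc_group r f) \<subseteq> \<real> \<and>
        \<eta> \<in> {drackn_theta n r c, drackn_tau n r c} \<and>
        (\<forall>u v. of_real (x u \<bullet> x v) = (mat 1 - (1 / \<eta>) *\<^sub>R character_matrix f \<phi>) $ u $ v) \<and>
        meets_real_absolute_bound x)"

definition gives_complex_lines_meeting_absolute_bound ::
  "nat \<Rightarrow> nat \<Rightarrow> nat \<Rightarrow> ('v::finite \<Rightarrow> 'v \<Rightarrow> bool) \<Rightarrow> ('v \<Rightarrow> 'n::finite) \<Rightarrow> bool" where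
  "gives_complex_lines_meeting_absolute_bound n r c E p \<longleftrightarrow>
     (\<exists>f \<phi> \<eta>. \<exists>x :: 'n \<Rightarrow> complex^'n.
        abelian_presentation E p r f \<and>
        nontrivial_character (arc_group r f) \<phi> \<and>
        \<eta> \<in> {drackn_theta n r c, drackn_tau n r c} \<and>
        (\<forall>u v. cinner (x u) (x v) = (mat 1 - (1 / \<eta>) *\<^sub>R character_matrix f \<phi>) $ u $ v) \<and>
        meets_complex_absolute_bound x)"

end

theory Submission
  imports Defs "HOL-Algebra.Multiplicative_Group" "HOL-Algebra.Sylow"
begin

text \<open>Counting common neighbours gives \<open>A\<^sup>2 = (n - 1) I + \<delta> A + c (J - F)\<close> for the adjacency matrix
  \<open>A\<close>, where \<open>J\<close> is the all-ones matrix and \<open>F\<close> the fibre matrix; twisting the same count by a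
  non-trivial character gives \<open>S\<^sup>2 = (n - 1) I + \<delta> S\<close>. Hence, with \<open>{\<eta>, \<omega>} = {\<theta>, \<tau>}\<close>, the matrix
  \<open>I - S / \<eta>\<close> is \<open>1 - \<omega> / \<eta>\<close> times a projection, and comparing traces the lines span a space of
  dimension \<open>d = n \<eta> / (\<eta> - \<omega>)\<close>, which is also the multiplicity of \<open>\<omega>\<close> divided by \<open>r - 1\<close>. Together
  with \<open>\<eta> \<omega> = 1 - n\<close> the absolute bound becomes \<open>\<eta>\<^sup>2 = d + 2\<close> in the real and \<open>\<eta>\<^sup>2 = d + 1\<close> in the
  complex case, so \<open>t = \<bar>\<eta>\<bar>\<close> determines all parameters. As \<open>\<delta>\<close> is an integer, \<open>\<eta>\<close> is
  rational unless \<open>\<delta> = 0\<close>; then \<open>t = \<surd>5\<close> in the real case, while in the complex case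
  \<open>n = 4\<close> and \<open>rc = 2\<close>, which is impossible for odd \<open>r\<close>.\<close>

subsection \<open>Dimensions of tight frames\<close>

text \<open>Symmetry makes \<open>Q\<close> vanish on the orthogonal complement of \<open>V\<close>,
  so \<open>Q\<close> is \<mu> times the orthogonal projection onto \<open>V\<close>. Its trace is
  found by exchanging the sums over the standard basis and over an orthonormal basis of
  \<open>V\<close>, whose members each contribute \<mu>.\<close>

lemma trace_scaled_projection:
  fixes Q :: "'a::euclidean_space \<Rightarrow> 'a"
  assumes V: "subspace V" and range: "\<And>x. Q x \<in> V"
    and scale: "\<And>x. x \<in> V \<Longrightarrow> Q x = \<mu> *\<^sub>R x"
    and sym: "\<And>x y. Q x \<bullet> y = x \<bullet> Q y"
  shows "(\<Sum>b\<in>Basis. Q b \<bullet> b) = \<mu> * real (dim V)"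
proof -
  obtain B where B: "B \<subseteq> V" "pairwise orthogonal B" "\<And>x. x \<in> B \<Longrightarrow> norm x = 1"
    "independent B" "card B = dim V" "span B = V"
    using orthonormal_basis_subspace[OF V] by metis
  have fin: "finite B" using B(4) by (rule independent_imp_finite)
  have "Q b \<bullet> b = (\<Sum>e\<in>B. \<mu> * (e \<bullet> b)\<^sup>2)" for b
  proof -
    have "Q b = (\<Sum>e\<in>B. (Q b \<bullet> e) *\<^sub>R e)"
      using orthonormal_basis_expand[OF B(2,3) _ fin, of "Q b"] range B(6) by simp
    \<comment> \<open>By symmetry the coefficient is \<open>b \<bullet> Q e\<close>, and
      \<open>e\<close> lies in \<open>V\<close>, where \<open>Q\<close> is scaling by \<mu>.\<close>
    also have "\<dots> = (\<Sum>e\<in>B. (\<mu> * (e \<bullet> b)) *\<^sub>R e)"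
      by (intro sum.cong refl) (metis B(1) inner_scaleR_left inner_commute scale subsetD sym)
    finally show ?thesis
      by (simp add: inner_sum_left power2_eq_square mult.assoc)
  qed
  then have "(\<Sum>b\<in>Basis. Q b \<bullet> b) = (\<Sum>e\<in>B. \<mu> * (\<Sum>b\<in>Basis. (e \<bullet> b)\<^sup>2))"
    by (simp add: sum.swap[of _ B] sum_distrib_left)
  also have "\<dots> = (\<Sum>e\<in>B. \<mu> * (e \<bullet> e))"
    by (simp add: euclidean_inner[of e e for e] power2_eq_square)
  also have "\<dots> = (\<Sum>e\<in>B. \<mu>)"
    by (intro sum.cong refl) (use B(3) in \<open>auto simp: norm_eq_1\<close>)
  finally show ?thesis by (simp add: B(5))
qed

text \<open>The hypothesis says that the frame operator \<open>Q\<close> acts as \<mu> on every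
  frame vector, hence by linearity on their span, which also contains its range. Its trace is the
  sum of the squared norms of the frame vectors.\<close>

lemma tight_frame_dim:
  fixes x :: "'i::finite \<Rightarrow> 'a::euclidean_space"
  assumes "\<And>v. (\<Sum>u\<in>UNIV. (x v \<bullet> x u) *\<^sub>R x u) = \<mu> *\<^sub>R x v"
  shows "(\<Sum>u\<in>UNIV. x u \<bullet> x u) = \<mu> * real (dim (range x))"
proof -
  define Q where "Q y = (\<Sum>u\<in>UNIV. (y \<bullet> x u) *\<^sub>R x u)" for y
  have lin: "linear Q"
    unfolding Q_def
    by (intro linearI) (simp_all add: inner_add_left scaleR_add_left sum.distrib scaleR_sum_right)
  have "(\<Sum>b\<in>Basis. Q b \<bullet> b) = \<mu> * real (dim (span (range x)))"
  proof (rule trace_scaled_projection)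
    show "Q y \<in> span (range x)" for y
      unfolding Q_def by (intro span_sum span_scale span_base) auto
    show "Q y = \<mu> *\<^sub>R y" if "y \<in> span (range x)" for y
      using linear_eq_on_span[OF lin linear_scale_self[of \<mu>] _ that] assms
      by (auto simp: Q_def)
    show "Q y \<bullet> z = y \<bullet> Q z" for y z
      unfolding Q_def inner_sum_left inner_sum_right
      by (intro sum.cong refl) (simp add: inner_commute)
  qed auto
  moreover have "(\<Sum>b\<in>Basis. Q b \<bullet> b) = (\<Sum>u\<in>UNIV. x u \<bullet> x u)"
    unfolding Q_def inner_sum_left
    by (subst sum.swap) (simp add: euclidean_inner[of "x u" "x u" for u] inner_commute)
  ultimately show ?thesis by simp
qed

section \<open>Complex dimension as half of the real dimension\<close>

lemma scaleR_eq_vec_scale: "a *\<^sub>R (x :: complex^'n) = complex_of_real a *s x"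
  by (simp add: vec_eq_iff complex_eq_iff)

lemma subspace_vec_span: "subspace (vec.span (S :: (complex^'n) set))"
  by (simp add: subspace_def vec.span_zero vec.span_add vec.span_scale scaleR_eq_vec_scale)

text \<open>A vector outside a complex subspace contributes the two real directions \<open>b\<close>
  and \<open>\<i> *s b\<close>.\<close>

lemma dim_vec_span_insert:
  fixes b :: "complex^'n"
  assumes "b \<notin> vec.span S"
  shows "dim (vec.span (insert b S)) = dim (vec.span S) + 2"
proof -
  let ?W = "vec.span S"
  have eqW: "span ?W = ?W"
    by (simp add: span_eq_iff subspace_vec_span)
  \<comment> \<open>Otherwise \<open>(\<i> - t) *s b\<close> lies in the complex span of
    \<open>S\<close> for some real \<open>t\<close>; as \<open>\<i> - t\<close> is invertible, so
    does \<open>b\<close>.\<close>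
  have ib: "\<i> *s b \<notin> span (insert b ?W)"
  proof
    assume "\<i> *s b \<in> span (insert b ?W)"
    then obtain t where "\<i> *s b - t *\<^sub>R b \<in> ?W"
      by (metis eqW span_breakdown_eq)
    then have "(\<i> - of_real t) *s b \<in> ?W"
      by (simp add: scaleR_eq_vec_scale vec.scale_left_diff_distrib)
    then have "(1 / (\<i> - of_real t)) *s ((\<i> - of_real t) *s b) \<in> ?W"
      by (rule vec.span_scale)
    moreover have "\<i> - of_real t \<noteq> 0" by (simp add: complex_eq_iff)
    ultimately show False
      using assms by (simp only: vec.scale_scale) simp
  qed
  have "span (insert (\<i> *s b) (insert b ?W)) = vec.span (insert b S)"
  proof
    have "insert (\<i> *s b) (insert b ?W) \<subseteq> vec.span (insert b S)"
      using vec.span_mono[of S "insert b S"]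
      by (auto intro: vec.span_base vec.span_scale)
    then show "span (insert (\<i> *s b) (insert b ?W)) \<subseteq> vec.span (insert b S)"
      by (rule span_minimal) (rule subspace_vec_span)
    show "vec.span (insert b S) \<subseteq> span (insert (\<i> *s b) (insert b ?W))"
    proof
      fix y assume "y \<in> vec.span (insert b S)"
      then obtain k where "y - k *s b \<in> ?W"
        by (auto simp: vec.span_breakdown_eq)
      moreover have "y = (y - k *s b) + (Re k *\<^sub>R b + Im k *\<^sub>R (\<i> *s b))"
        by (simp add: vec_eq_iff complex_eq_iff)
      ultimately show "y \<in> span (insert (\<i> *s b) (insert b ?W))"
        by (metis insertCI span_add span_base span_scale)
    qed
  qed
  then have "dim (vec.span (insert b S)) = dim (insert (\<i> *s b) (insert b ?W))"
    by (metis dim_span)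
  then show ?thesis
    using ib assms eqW by (simp add: dim_insert)
qed

text \<open>Induction over a complex basis, each of whose vectors adds two real dimensions.\<close>

lemma dim_vec_span: "dim (vec.span S) = 2 * vec.dim (S :: (complex^'n) set)"
proof -
  obtain B where B: "B \<subseteq> S" "vec.independent B" "S \<subseteq> vec.span B" "card B = vec.dim S"
    by (rule vec.basis_exists)
  have fin: "finite B" using B(2) by (rule vec.finiteI_independent)
  have "dim (vec.span B) = 2 * card B"
    using fin B(2)
  proof (induction B rule: finite_induct)
    case (insert b B)
    then show ?case
      by (simp add: dim_vec_span_insert vec.independent_insert)
  qed simp
  moreover have "vec.span S = vec.span B"
    using B by (metis vec.span_mono vec.span_span subset_antisym)
  ultimately show ?thesis using B by simp
qed

lemma inner_eq_Re_cinner: "x \<bullet> y = Re (cinner x y)"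
  by (simp add: inner_vec_def cinner_def inner_complex_def)

lemma cinner_scale_left: "cinner (a *s x) y = a * cinner x y"
  by (simp add: cinner_def sum_distrib_left mult.assoc)

lemma cinner_scale_right: "cinner x (a *s y) = cnj a * cinner x y"
  by (simp add: cinner_def sum_distrib_left mult_ac)

lemma cinner_sum_left: "cinner (\<Sum>i\<in>I. f i) y = (\<Sum>i\<in>I. cinner (f i) y)"
  by (simp add: cinner_def sum_distrib_right) (rule sum.swap)

lemma cinner_diff_left: "cinner (x - y) z = cinner x z - cinner y z"
  by (simp add: cinner_def sum_subtractf left_diff_distrib)

text \<open>A complex tight frame \<open>x\<close> becomes a real one on adjoining the vectors \<open>\<i> x\<close>.\<close>

lemma complex_tight_frame_dim:
  fixes x :: "'i::finite \<Rightarrow> complex^'n"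
  assumes "\<And>v. (\<Sum>u\<in>UNIV. cinner (x v) (x u) *s x u) = of_real \<mu> *s x v"
  shows "(\<Sum>u\<in>UNIV. Re (cinner (x u) (x u))) = \<mu> * real (vec.dim (range x))"
proof -
  \<comment> \<open>The Boolean index selects \<open>x u\<close> or its multiple by
    \<open>\<i>\<close>.\<close>
  define y where "y = (\<lambda>(u, s). (if s then \<i> else 1) *s x u)"
  have sum_y: "(\<Sum>q\<in>UNIV. f q) = (\<Sum>u\<in>UNIV. f (u, True) + f (u, False))"
    for f :: "'i \<times> bool \<Rightarrow> 'b::comm_monoid_add"
    using sum.cartesian_product[of "\<lambda>u s. f (u, s)" "UNIV :: bool set" "UNIV :: 'i set"]
    by (simp add: UNIV_bool add.commute flip: UNIV_Times_UNIV)
  \<comment> \<open>The real inner products of \<open>z\<close> with \<open>x u\<close> and with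
    \<open>\<i> *s x u\<close> are the real and imaginary parts of \<open>cinner z (x u)\<close>, so
    the two real terms add up to one complex term.\<close>
  have frame: "(\<Sum>q\<in>UNIV. (z \<bullet> y q) *\<^sub>R y q) = (\<Sum>u\<in>UNIV. cinner z (x u) *s x u)" for z
    unfolding sum_y
    by (intro sum.cong refl)
      (simp add: y_def inner_eq_Re_cinner cinner_scale_right vec_eq_iff complex_eq_iff)
  have "(\<Sum>q\<in>UNIV. (y p \<bullet> y q) *\<^sub>R y q) = \<mu> *\<^sub>R y p" for p
  proof -
    obtain v s where p: "p = (v, s)" by fastforce
    let ?e = "if s then \<i> else 1"
    have y_p: "y p = ?e *s x v" by (simp add: y_def p)
    have "(\<Sum>q\<in>UNIV. (y p \<bullet> y q) *\<^sub>R y q) = (\<Sum>u\<in>UNIV. cinner (y p) (x u) *s x u)"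
      by (rule frame)
    also have "\<dots> = ?e *s (\<Sum>u\<in>UNIV. cinner (x v) (x u) *s x u)"
      by (simp only: y_p cinner_scale_left vec.scale_sum_right vec.scale_scale)
    also have "\<dots> = \<mu> *\<^sub>R y p"
      by (simp only: assms scaleR_eq_vec_scale y_p vec.scale_scale mult.commute)
    finally show ?thesis .
  qed
  then have frame_y: "(\<Sum>q\<in>UNIV. y q \<bullet> y q) = \<mu> * real (dim (range y))"
    by (rule tight_frame_dim)
  have norms: "(\<Sum>q\<in>UNIV. y q \<bullet> y q) = 2 * (\<Sum>u\<in>UNIV. Re (cinner (x u) (x u)))"
    unfolding sum_y sum_distrib_left
    by (intro sum.cong refl)
      (simp add: y_def inner_eq_Re_cinner cinner_scale_left cinner_scale_right)
  have "span (range y) = vec.span (range x)"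
  proof
    show "span (range y) \<subseteq> vec.span (range x)"
      by (rule span_minimal)
        (auto simp: y_def subspace_vec_span intro: vec.span_base vec.span_scale)
    \<comment> \<open>The real span of \<open>y\<close> is closed under complex scaling, because
      with each \<open>x u\<close> it contains \<open>\<i> *s x u\<close>.\<close>
    have "vec.subspace (span (range y))"
    proof (rule vec.subspaceI)
      fix a z assume "z \<in> span (range y)"
      then show "a *s z \<in> span (range y)"
      proof (induction rule: span_induct_alt)
        case base
        then show ?case by (simp add: span_zero)
      next
        case (step t w z)
        then obtain u s where w: "w = (if s then \<i> else 1) *s x u"
          by (auto simp: y_def)
        have 1: "x u \<in> range y" "\<i> *s x u \<in> range y"
          by (auto simp: y_def intro: range_eqI[of _ _ "(u, False)"] range_eqI[of _ _ "(u, True)"])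
        have "a *s (t *\<^sub>R w) \<in> span (range y)"
        proof -
          have "b *s x u \<in> span (range y)" for b
          proof -
            have "b *s x u = Re b *\<^sub>R x u + Im b *\<^sub>R (\<i> *s x u)"
              by (simp add: vec_eq_iff complex_eq_iff)
            also have "\<dots> \<in> span (range y)"
              by (intro span_add span_scale span_base 1)
            finally show ?thesis .
          qed
          then show ?thesis by (simp add: w scaleR_eq_vec_scale)
        qed
        then show ?case
          using step by (simp add: vec.scale_right_distrib span_add)
      qed
    qed (auto intro: span_zero span_add)
    moreover have "range x \<subseteq> span (range y)"
    proof
      fix w assume "w \<in> range x"
      then obtain u where "w = y (u, False)" by (auto simp: y_def)
      then show "w \<in> span (range y)" by (auto intro: span_base)
    qed
    ultimately show "vec.span (range x) \<subseteq> span (range y)"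
      by (intro vec.span_minimal)
  qed
  then have dim_y: "dim (range y) = 2 * vec.dim (range x)"
    using dim_span[of "range y"] dim_vec_span[of "range x"] by simp
  \<comment> \<open>Doubling the family doubles both the sum of the squared norms and the dimension,
    so the factor 2 cancels.\<close>
  have "2 * (\<Sum>u\<in>UNIV. Re (cinner (x u) (x u))) = \<mu> * real (dim (range y))"
    using norms frame_y by (rule trans[OF sym])
  also have "\<dots> = 2 * (\<mu> * real (vec.dim (range x)))"
    by (simp only: dim_y of_nat_mult of_nat_numeral mult.left_commute)
  finally show ?thesis by linarith
qed

text \<open>If the Gram matrix squares to \<mu> times itself, the vectors form a tight frame: the
  defect \<open>d\<close> in the frame identity is a linear combination of the vectors and
  orthogonal to all of them, hence zero.\<close>

lemma real_gram_dim:
  fixes x :: "'i::finite \<Rightarrow> real^'k"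
  assumes "\<And>v w. (\<Sum>u\<in>UNIV. (x v \<bullet> x u) * (x u \<bullet> x w)) = \<mu> * (x v \<bullet> x w)"
  shows "(\<Sum>u\<in>UNIV. x u \<bullet> x u) = \<mu> * real (dim (range x))"
proof (rule tight_frame_dim)
  fix v
  define d where "d = (\<Sum>u\<in>UNIV. (x v \<bullet> x u) *\<^sub>R x u) - \<mu> *\<^sub>R x v"
  have perp: "d \<bullet> x w = 0" for w
    by (simp add: d_def inner_diff_left inner_sum_left assms)
  have "d \<bullet> d = d \<bullet> (\<Sum>u\<in>UNIV. (x v \<bullet> x u) *\<^sub>R x u) - d \<bullet> (\<mu> *\<^sub>R x v)"
    unfolding inner_diff_right[symmetric] by (simp only: d_def)
  also have "\<dots> = 0"
    by (simp add: inner_sum_right perp)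
  finally show "(\<Sum>u\<in>UNIV. (x v \<bullet> x u) *\<^sub>R x u) = \<mu> *\<^sub>R x v"
    by (simp add: d_def)
qed

lemma cinner_sum_right: "cinner x (\<Sum>i\<in>I. f i) = (\<Sum>i\<in>I. cinner x (f i))"
  unfolding cinner_def sum_component cnj_sum sum_distrib_left by (rule sum.swap)

lemma cinner_diff_right: "cinner x (y - z) = cinner x y - cinner x z"
  by (simp add: cinner_def sum_subtractf right_diff_distrib)

text \<open>Hermitian counterpart of \<open>real_gram_dim\<close>: here too the defect
  \<open>d\<close> is orthogonal to the span in which it lies.\<close>

lemma complex_gram_dim:
  fixes x :: "'i::finite \<Rightarrow> complex^'k"
  assumes "\<And>v w. (\<Sum>u\<in>UNIV. cinner (x v) (x u) * cinner (x u) (x w)) = of_real \<mu> * cinner (x v) (x w)"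
  shows "(\<Sum>u\<in>UNIV. Re (cinner (x u) (x u))) = \<mu> * real (vec.dim (range x))"
proof (rule complex_tight_frame_dim)
  fix v
  define d where "d = (\<Sum>u\<in>UNIV. cinner (x v) (x u) *s x u) - of_real \<mu> *s x v"
  have perp: "cinner d (x w) = 0" for w
    by (simp add: d_def cinner_diff_left cinner_sum_left cinner_scale_left assms)
  have "cinner d d = cinner d (\<Sum>u\<in>UNIV. cinner (x v) (x u) *s x u) - cinner d (of_real \<mu> *s x v)"
    unfolding cinner_diff_right[symmetric] by (simp only: d_def)
  also have "\<dots> = 0"
    by (simp add: cinner_sum_right cinner_scale_right perp)
  finally have "d \<bullet> d = 0" by (simp add: inner_eq_Re_cinner)
  then show "(\<Sum>u\<in>UNIV. cinner (x v) (x u) *s x u) = of_real \<mu> *s x v"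
    by (simp add: d_def)
qed

subsection \<open>Characters of finite abelian groups\<close>

lemma linear_character_mult:
  "linear_character G \<phi> \<Longrightarrow> x \<in> carrier G \<Longrightarrow> y \<in> carrier G \<Longrightarrow>
    \<phi> (x \<otimes>\<^bsub>G\<^esub> y) = \<phi> x * \<phi> y"
  by (simp add: linear_character_def hom_def)

lemma linear_character_one:
  fixes G (structure)
  assumes "group G" "linear_character G \<phi>"
  shows "\<phi> \<one>\<^bsub>G\<^esub> = 1"
proof -
  interpret group G by fact
  have "\<phi> \<one> \<noteq> 0"
    using funcset_mem[OF _ one_closed, of \<phi> "UNIV - {0}"] assms(2)
    by (simp add: linear_character_def hom_def)
  moreover have "\<phi> (\<one> \<otimes> \<one>) = \<phi> \<one> * \<phi> \<one>"
    by (rule linear_character_mult[OF assms(2) one_closed one_closed])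
  ultimately show ?thesis by simp
qed

lemma linear_character_pow:
  fixes G (structure)
  assumes "group G" "linear_character G \<phi>" "x \<in> carrier G"
  shows "\<phi> (x [^]\<^bsub>G\<^esub> (k::nat)) = \<phi> x ^ k"
proof -
  interpret group G by fact
  show ?thesis
    using assms(3)
    by (induction k) (simp_all add: linear_character_one[OF assms(1,2)]
        linear_character_mult[OF assms(2)])
qed

text \<open>The values are roots of unity, since raising \<open>x\<close> to the group order gives
  the identity.\<close>

lemma cmod_linear_character:
  fixes G (structure)
  assumes "group G" "finite (carrier G)" "linear_character G \<phi>" "x \<in> carrier G"
  shows "cmod (\<phi> x) = 1"
proof -
  interpret group G by fact
  have "\<phi> x ^ order G = 1"
    using pow_order_eq_1[OF assms(4)] linear_character_pow[OF assms(1,3,4), of "order G"]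
      linear_character_one[OF assms(1,3)] by simp
  moreover have "order G > 0"
    using assms(2) order_gt_0_iff_finite by blast
  ultimately show ?thesis
    by (metis norm_ge_zero norm_one norm_power power_eq_1_iff less_numeral_extra(3))
qed

text \<open>Translation by an \<open>a\<close> with \<open>\<phi> a \<noteq> 1\<close> permutes the
  group but multiplies the sum by \<open>\<phi> a\<close>.\<close>

lemma sum_nontrivial_character:
  fixes G (structure)
  assumes "group G" "finite (carrier G)" "nontrivial_character G \<phi>"
  shows "(\<Sum>g\<in>carrier G. \<phi> g) = 0"
proof -
  interpret group G by fact
  obtain a where a: "a \<in> carrier G" "\<phi> a \<noteq> 1" and lin: "linear_character G \<phi>"
    using assms(3) by (auto simp: nontrivial_character_def)
  have "bij_betw (\<lambda>g. a \<otimes> g) (carrier G) (carrier G)"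
    by (rule bij_betwI[where g = "\<lambda>g. inv a \<otimes> g"]) (use a in \<open>auto simp: m_assoc[symmetric]\<close>)
  then have "(\<Sum>g\<in>carrier G. \<phi> g) = (\<Sum>g\<in>carrier G. \<phi> (a \<otimes> g))"
    by (rule sum.reindex_bij_betw[symmetric])
  also have "\<dots> = \<phi> a * (\<Sum>g\<in>carrier G. \<phi> g)"
    by (simp add: sum_distrib_left linear_character_mult[OF lin a(1)])
  finally show ?thesis using a by simp
qed

text \<open>Modulo a maximal proper subgroup \<open>H\<close> containing \<open>K\<close>, any \<open>a \<notin> H\<close> generates the group, so
  \<open>a\<^sup>k h \<mapsto> exp (2 \<pi> \<i> k / m)\<close> is a character, where \<open>m\<close> is the order of \<open>a\<close> modulo \<open>H\<close>.\<close>

lemma exists_character_trivial_on_subgroup: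
  fixes G (structure)
  assumes comm: "comm_group G" and fin: "finite (carrier G)"
    and K: "subgroup K G" "K \<noteq> carrier G"
  obtains \<phi> where "nontrivial_character G \<phi>" "\<And>g. g \<in> K \<Longrightarrow> \<phi> g = 1"
proof -
  interpret comm_group G by fact
  let ?S = "{H. subgroup H G \<and> H \<noteq> carrier G}"
  have "finite ?S"
    by (rule finite_subset[of _ "Pow (carrier G)"]) (use fin in \<open>auto dest: subgroup.subset\<close>)
  from finite_has_maximal2[OF this, of K]
  obtain H where "H \<in> ?S" "K \<subseteq> H" and max': "\<forall>L\<in>?S. H \<subseteq> L \<longrightarrow> H = L"
    using K by auto
  then have H: "subgroup H G" "H \<noteq> carrier G" "K \<subseteq> H" by simp_all
  have max: "L = H" if "subgroup L G" "L \<noteq> carrier G" "H \<subseteq> L" for L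
    using max' that by blast
  interpret H: subgroup H G by fact
  obtain a where a: "a \<in> carrier G" "a \<notin> H"
    using H.subset H(2) by blast
  \<comment> \<open>\<open>L\<close> is the subgroup generated by \<open>H\<close> and
    \<open>a\<close>; it properly contains \<open>H\<close>, so maximality makes it the whole
    group.\<close>
  define L where "L = {a [^] k \<otimes> h | (k::int) h. h \<in> H}"
  have mul: "(a [^] k \<otimes> h) \<otimes> (a [^] l \<otimes> h') = a [^] (k + l) \<otimes> (h \<otimes> h')"
    if "h \<in> H" "h' \<in> H" for k l :: int and h h'
    using that a H.mem_carrier by (simp add: int_pow_mult m_ac)
  have "subgroup L G"
  proof (rule subgroupI)
    show "L \<subseteq> carrier G"
      using a H.mem_carrier by (auto simp: L_def)
    show "L \<noteq> {}"
      unfolding L_def using H.one_closed by blast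
    show "inv x \<in> L" if x: "x \<in> L" for x
    proof -
      obtain k :: int and h where x: "x = a [^] k \<otimes> h" "h \<in> H"
        using x unfolding L_def by blast
      then have "inv x = a [^] (- k) \<otimes> inv h"
        using a H.mem_carrier by (simp add: inv_mult int_pow_neg)
      then show ?thesis using x H.m_inv_closed unfolding L_def by blast
    qed
    show "x \<otimes> y \<in> L" if xy: "x \<in> L" "y \<in> L" for x y
    proof -
      obtain k :: int and h and l :: int and h' where "x = a [^] k \<otimes> h" "h \<in> H" "y = a [^] l \<otimes> h'" "h' \<in> H"
        using xy unfolding L_def by blast
      then show ?thesis using mul H.m_closed unfolding L_def by blast
    qed
  qed
  moreover have "H \<subseteq> L"
  proof
    fix h assume "h \<in> H"
    moreover from this have "h = a [^] (0::int) \<otimes> h" by simp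
    ultimately show "h \<in> L" unfolding L_def by blast
  qed
  moreover have "a \<in> L"
  proof -
    have "a = a [^] (1::int) \<otimes> \<one>" using a by simp
    then show ?thesis unfolding L_def using H.one_closed by blast
  qed
  ultimately have L: "L = carrier G" using max a(2) by blast
  define m where "m = (LEAST m::nat. m > 0 \<and> a [^] m \<in> H)"
  have "\<exists>m::nat. m > 0 \<and> a [^] m \<in> H"
    using pow_order_eq_1[OF a(1)] H.one_closed fin order_gt_0_iff_finite by metis
  then have m: "m > 0" "a [^] m \<in> H"
    unfolding m_def by (rule LeastI2_ex, simp)+
  \<comment> \<open>Division with remainder: a nonzero remainder of \<open>k\<close> modulo
    \<open>m\<close> would be a smaller positive exponent taking \<open>a\<close> into
    \<open>H\<close>.\<close>
  have dvd: "int m dvd k" if k: "a [^] k \<in> H" for k :: int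
  proof (rule ccontr)
    assume "\<not> int m dvd k"
    then have "k mod int m > 0"
      using m(1) by (simp add: dvd_eq_mod_eq_0 order.not_eq_order_implies_strict)
    then have pos: "nat (k mod int m) > 0" "nat (k mod int m) < m"
      using m(1) by (simp_all add: nat_less_iff)
    have "a [^] (k mod int m) = a [^] k \<otimes> inv ((a [^] int m) [^] (k div int m))"
      using a by (simp add: minus_mult_div_eq_mod[symmetric] int_pow_diff int_pow_pow)
    also have "\<dots> \<in> H"
      using k m(2) by (simp add: int_pow_int subgroup_int_pow_closed[OF H(1)])
    finally have "a [^] nat (k mod int m) \<in> H"
      using m(1) by (simp add: int_pow_int[symmetric])
    then show False
      using pos not_less_Least[of "nat (k mod int m)"] unfolding m_def by blast
  qed
  define \<omega> where "\<omega> k = cis (2 * pi * (of_int k / real m))" for k :: int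
  have \<omega>_add: "\<omega> (k + l) = \<omega> k * \<omega> l" for k l
    by (simp add: \<omega>_def cis_mult add_divide_distrib distrib_left)
  have \<omega>_dvd: "\<omega> k = 1" if "int m dvd k" for k
  proof -
    have "real_of_int k / real m \<in> \<int>"
      using that m(1) by (auto elim!: dvdE)
    then show ?thesis unfolding \<omega>_def by (rule cis_multiple_2pi)
  qed
  \<comment> \<open>The value is chosen through some representation of \<open>g\<close> as a power
    of \<open>a\<close> times an element of \<open>H\<close>. It is well defined: the exponents of
    two representations differ by some \<open>k - l\<close> with \<open>a [^] (k - l)\<close> in
    \<open>H\<close>, hence by a multiple of \<open>m\<close>, which \<omega> ignores.\<close>
  define \<phi> where "\<phi> g = (SOME z. \<exists>k h. h \<in> H \<and> g = a [^] k \<otimes> h \<and> z = \<omega> k)" for g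
  have \<phi>: "\<phi> (a [^] k \<otimes> h) = \<omega> k" if h: "h \<in> H" for k h
  proof -
    have "z = \<omega> k" if z: "\<exists>l h'. h' \<in> H \<and> a [^] k \<otimes> h = a [^] l \<otimes> h' \<and> z = \<omega> l" for z
    proof -
      obtain l h' where l: "h' \<in> H" "a [^] k \<otimes> h = a [^] l \<otimes> h'" "z = \<omega> l" using z by blast
      have "a [^] (k - l) = a [^] k \<otimes> h \<otimes> inv h \<otimes> inv (a [^] l)"
        using a h H.mem_carrier by (simp add: int_pow_diff m_assoc)
      also have "\<dots> = h' \<otimes> inv h"
      proof -
        have "a [^] l \<in> carrier G" "h' \<in> carrier G" "inv h \<in> carrier G"
          using a h l(1) H.mem_carrier by simp_all
        then show ?thesis
          unfolding l(2) by (metis inv_solve_right m_assoc m_closed m_comm)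
      qed
      finally have "int m dvd k - l" using dvd h l by simp
      then show ?thesis using \<omega>_dvd[of "k - l"] \<omega>_add[of "k - l" l] l by simp
    qed
    then show ?thesis
      unfolding \<phi>_def using h by (intro some_equality) blast+
  qed
  have "linear_character G \<phi>"
    unfolding linear_character_def
  proof (rule homI, simp_all)
    fix x assume "x \<in> carrier G"
    then obtain k :: int and h where x: "x = a [^] k \<otimes> h" "h \<in> H"
      unfolding L[symmetric] L_def by blast
    then show "\<phi> x \<noteq> 0" by (simp add: \<phi> \<omega>_def)
    fix y assume "y \<in> carrier G"
    then obtain l :: int and h' where y: "y = a [^] l \<otimes> h'" "h' \<in> H"
      unfolding L[symmetric] L_def by blast
    show "\<phi> (x \<otimes> y) = \<phi> x * \<phi> y"
      unfolding x(1) y(1) mul[OF x(2) y(2)] using x y by (simp add: \<phi> \<omega>_add)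
  qed
  \<comment> \<open>\<open>\<phi> a\<close> is a primitive \<open>m\<close>-th root of unity; if it
    were 1, then \<open>m = 1\<close> and \<open>a\<close> would lie in \<open>H\<close>.\<close>
  moreover have "\<phi> a \<noteq> 1"
  proof
    assume "\<phi> a = 1"
    then have "\<omega> 1 = 1" using \<phi>[of \<one> 1] a H.one_closed by simp
    then have "cos (2 * pi / real m) = 1" by (simp add: \<omega>_def complex_eq_iff)
    then obtain j where "2 * pi / real m = of_int j * 2 * pi"
      using cos_one_2pi_int by blast
    then have "of_int j * of_nat m = (1::real)" using m(1) pi_neq_zero by (simp add: field_simps)
    then have "j * int m = 1" by (metis of_int_1 of_int_eq_iff of_int_mult of_int_of_nat_eq)
    then have "m = 1" using m(1) by (simp add: zmult_eq_1_iff)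
    then show False using m(2) a by simp
  qed
  moreover have "\<phi> g = 1" if "g \<in> K" for g
  proof -
    have "g \<in> H" using that H(3) by blast
    then show ?thesis using \<phi>[of g 0] by (simp add: \<omega>_def)
  qed
  ultimately show ?thesis
    using that a(1) by (auto simp: nontrivial_character_def)
qed

lemma exists_nontrivial_character:
  assumes "comm_group G" "finite (carrier G)" "card (carrier G) \<noteq> 1"
  obtains \<phi> where "nontrivial_character G \<phi>"
proof -
  interpret comm_group G by fact
  have "{\<one>\<^bsub>G\<^esub>} \<noteq> carrier G" using assms(3) by (metis card_1_singleton_iff is_singletonI is_singleton_altdef)
  then show ?thesis
    using exists_character_trivial_on_subgroup[OF assms(1,2) triv_subgroup] that by blast
qed

text \<open>In a finite abelian group of even order squaring is not injective, so the squares form a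
  proper subgroup, and characters that are trivial on squares have values \<open>\<plusminus>1\<close>.\<close>

lemma exists_real_nontrivial_character:
  fixes G (structure)
  assumes comm: "comm_group G" and fin: "finite (carrier G)" and even: "even (card (carrier G))"
  obtains \<phi> where "nontrivial_character G \<phi>" "\<phi> ` carrier G \<subseteq> \<real>"
proof -
  interpret comm_group G by fact
  define K where "K = (\<lambda>g. g \<otimes> g) ` carrier G"
  have K: "subgroup K G"
  proof (rule subgroupI)
    show "inv x \<in> K" if x: "x \<in> K" for x
    proof -
      obtain g where "g \<in> carrier G" "x = g \<otimes> g" using x unfolding K_def by blast
      then have "inv x = inv g \<otimes> inv g" "inv g \<in> carrier G" by (simp_all add: inv_mult)
      then show ?thesis unfolding K_def by blast
    qed
    show "x \<otimes> y \<in> K" if xy: "x \<in> K" "y \<in> K" for x y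
    proof -
      obtain g h where "g \<in> carrier G" "h \<in> carrier G" "x = g \<otimes> g" "y = h \<otimes> h"
        using xy unfolding K_def by blast
      then have "x \<otimes> y = (g \<otimes> h) \<otimes> (g \<otimes> h)" "g \<otimes> h \<in> carrier G" by (simp_all add: m_ac)
      then show ?thesis unfolding K_def by blast
    qed
  qed (auto simp: K_def)
  \<comment> \<open>Sylow's theorem for the factor 2 of the group order yields a subgroup of order
    2, and with it an involution \<open>t\<close>.\<close>
  obtain k where "order G = 2 ^ 1 * k" using even by (auto simp: order_def)
  then obtain T where T: "subgroup T G" "card T = 2 ^ 1"
    using sylow_thm[OF two_is_prime_nat is_group _ fin, of 1 k] by auto
  have "K \<noteq> carrier G"
  proof
    assume "K = carrier G"
    \<comment> \<open>On a finite set a surjective squaring map is injective, but \<open>t\<close>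
      and the identity have the same square.\<close>
    then have inj: "inj_on (\<lambda>g. g \<otimes> g) (carrier G)"
      unfolding K_def using fin by (intro eq_card_imp_inj_on) auto
    obtain t where t: "t \<in> T" "t \<noteq> \<one>"
    proof -
      have "\<not> T \<subseteq> {\<one>}"
      proof
        assume "T \<subseteq> {\<one>}"
        then have "card T \<le> card {\<one>}" by (intro card_mono) simp_all
        then show False using T(2) by simp
      qed
      then show ?thesis using that by blast
    qed
    have tG: "t \<in> carrier G" using subgroup.mem_carrier[OF T(1) t(1)] .
    have "t \<otimes> t = \<one> \<otimes> \<one>"
    proof -
      interpret T: group "G\<lparr>carrier := T\<rparr>"
        using T(1) by (rule subgroup_imp_group)
      have "t [^]\<^bsub>G\<lparr>carrier := T\<rparr>\<^esub> card T = \<one>"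
        using T.pow_order_eq_1[of t] t by (simp add: order_def)
      then have "t [^] card T = \<one>"
        by (subst nat_pow_consistent[of _ _ T])
      then show ?thesis using T(2) tG by (simp add: numeral_2_eq_2)
    qed
    from inj_onD[OF inj this tG one_closed] have "t = \<one>" .
    with t show False by simp
  qed
  then obtain \<phi> where \<phi>: "nontrivial_character G \<phi>" "\<And>g. g \<in> K \<Longrightarrow> \<phi> g = 1"
    using exists_character_trivial_on_subgroup[OF comm fin K] by blast
  have "\<phi> g \<in> \<real>" if "g \<in> carrier G" for g
  proof -
    have "\<phi> g * \<phi> g = 1"
      using \<phi> that linear_character_mult[of G \<phi> g g]
      by (auto simp: K_def nontrivial_character_def)
    then have "\<phi> g = 1 \<or> \<phi> g = - 1" by (simp add: square_eq_1_iff)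
    then show ?thesis by auto
  qed
  then show ?thesis using that \<phi>(1) by blast
qed

subsection \<open>Adjacency and eigenvalue multiplicities of a drackn\<close>

lemma relpowp_gdist:
  assumes "connected_graph E"
  shows "(E ^^ gdist E x y) x y"
  unfolding gdist_def
  by (rule LeastI_ex) (use assms in \<open>auto simp: connected_graph_def rtranclp_power\<close>)

lemma gdist_le_diameter: "gdist E x y \<le> diameter_graph (E :: 'v::finite \<Rightarrow> 'v \<Rightarrow> bool)"
proof -
  have "{gdist E x y | x y. True} = (\<lambda>(x, y). gdist E x y) ` UNIV" by auto
  then have "finite {gdist E x y | x y. True}" by simp
  then show ?thesis unfolding diameter_graph_def by (rule Max_ge) blast
qed

section \<open>Counting neighbours in covers of complete graphs\<close>

lemma sum_of_bool_eq_card: "(\<Sum>x\<in>UNIV. of_bool (P x)) = real (card {x :: 'a::finite. P x})"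
  by (simp add: of_bool_def sum.If_cases)

lemma sum_over_fibres:
  fixes p :: "'v::finite \<Rightarrow> 'n::finite" and g :: "'v \<Rightarrow> real"
  shows "(\<Sum>x\<in>UNIV. g x) = (\<Sum>v\<in>UNIV. \<Sum>x\<in>UNIV. g x * of_bool (p x = v))"
  by (subst sum.swap) (simp flip: sum_distrib_left)

lemma cover_symmetric: "cover_of_complete E p r \<Longrightarrow> E x y \<longleftrightarrow> E y x"
  by (auto simp: cover_of_complete_def simple_graph_def dest: sympD)

lemma cover_fibre_not_adjacent: "cover_of_complete E p r \<Longrightarrow> E x y \<Longrightarrow> p x \<noteq> p y"
  unfolding cover_of_complete_def by blast

lemma cover_fibre_ex1:
  "cover_of_complete E p r \<Longrightarrow> v \<noteq> p x \<Longrightarrow> \<exists>!y. p y = v \<and> E x y"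
  unfolding cover_of_complete_def by blast

lemma cover_neighbour_unique:
  assumes "cover_of_complete E p r" "E z w" "E z w'" "p w = p w'"
  shows "w = w'"
proof -
  have "p w \<noteq> p z" using cover_fibre_not_adjacent[OF assms(1,2)] by simp
  from cover_fibre_ex1[OF assms(1) this]
  obtain y where "\<And>y'. E z y' \<Longrightarrow> p y' = p w \<Longrightarrow> y' = y"
    by (elim ex1E) blast
  from this[of w] this[of w'] show ?thesis using assms(2-4) by simp
qed

lemma cover_neighbours_in_fibre:
  assumes "cover_of_complete E p r"
  shows "(\<Sum>y\<in>UNIV. of_bool (E x y) * of_bool (p y = v)) = (of_bool (v \<noteq> p x) :: real)"
proof -
  have "card {y. E x y \<and> p y = v} = of_bool (v \<noteq> p x)"
  proof (cases "v = p x")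
    case True
    then have "{y. E x y \<and> p y = v} = {}"
      using cover_fibre_not_adjacent[OF assms, of x] by fastforce
    then show ?thesis by (simp add: True)
  next
    case False
    from cover_fibre_ex1[OF assms False]
    obtain y where "E x y" "p y = v" "\<And>y'. E x y' \<Longrightarrow> p y' = v \<Longrightarrow> y' = y"
      by (elim ex1E) blast
    then have "{y. E x y \<and> p y = v} = {y}" by blast
    then show ?thesis by (simp add: False)
  qed
  then show ?thesis
    unfolding of_bool_conj[symmetric] sum_of_bool_eq_card by simp
qed

lemma sum_of_bool_neq: "(\<Sum>v\<in>UNIV. of_bool (v \<noteq> (u :: 'n::finite))) = real CARD('n) - 1"
proof -
  have "{v. v \<noteq> u} = UNIV - {u}" by auto
  then show ?thesis by (simp add: sum_of_bool_eq_card of_nat_diff Suc_le_eq)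
qed

lemma cover_degree:
  fixes p :: "'v::finite \<Rightarrow> 'n::finite"
  assumes "cover_of_complete E p r"
  shows "(\<Sum>y\<in>UNIV. of_bool (E x y)) = real CARD('n) - 1"
  by (subst sum_over_fibres[of _ p])
    (simp add: cover_neighbours_in_fibre[OF assms] sum_of_bool_neq)

lemma cover_card:
  fixes p :: "'v::finite \<Rightarrow> 'n::finite"
  assumes "cover_of_complete E p r"
  shows "real CARD('v) = real CARD('n) * real r"
  using sum_over_fibres[of "\<lambda>_. 1" p] assms
  by (simp add: sum_of_bool_eq_card cover_of_complete_def)

text \<open>The definition gives the count for non-adjacent vertices: none within a fibre, and
  \<open>c\<close> at distance two. For adjacent \<open>x\<close> and \<open>y\<close> it follows by
  counting the walks of length two from \<open>x\<close> into the fibre of \<open>y\<close> and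
  subtracting those to the other vertices of that fibre.\<close>

lemma drackn_common_neighbours:
  fixes p :: "'v::finite \<Rightarrow> 'n::finite"
  assumes X: "drackn n r c E p"
  shows "(\<Sum>z\<in>UNIV. of_bool (E x z) * of_bool (E z y)) =
    (real n - 1) * of_bool (x = y) + drackn_delta n r c * of_bool (E x y)
      + real c * of_bool (p x \<noteq> p y)" (is "?N y = _")
proof -
  have cov: "cover_of_complete E p r" and n: "CARD('n) = n"
    using X by (auto simp: drackn_def)
  note sym = cover_symmetric[OF cov]
  have fib: "p z \<noteq> p w" if "E z w" for z w
    using cover_fibre_not_adjacent[OF cov that] .
  then have irr: "\<not> E z z" for z
    by blast
  note uniq = cover_neighbour_unique[OF cov]
  have N_nonadj: "?N y' = real c" if "p x \<noteq> p y'" "\<not> E x y'" for y'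
  proof -
    have con: "connected_graph E"
      using X unfolding drackn_def distance_regular_def by blast
    \<comment> \<open>Distance 1 means adjacency, distances 0 and 3 mean a common fibre, and the
      diameter is 3; only distance 2 remains.\<close>
    have "gdist E x y' \<noteq> 1"
    proof
      assume "gdist E x y' = 1"
      then show False using relpowp_gdist[OF con, of x y'] that by (simp add: eq_OO)
    qed
    moreover have "gdist E x y' \<notin> {0, 3}"
      using X that unfolding drackn_def by blast
    moreover have "gdist E x y' \<le> 3"
      using X gdist_le_diameter[of E x y'] unfolding drackn_def by simp
    ultimately have "gdist E x y' = 2" by auto
    then have "card {z. E x z \<and> E z y'} = c"
      using X unfolding drackn_def by blast
    then show ?thesis
      unfolding of_bool_conj[symmetric] sum_of_bool_eq_card by simp
  qed
  consider "x = y" | "x \<noteq> y" "p x = p y" | "p x \<noteq> p y" "\<not> E x y" | "E x y" by blast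
  then show ?thesis
  proof cases
    case 1
    have "?N y = (\<Sum>z\<in>UNIV. of_bool (E x z))"
      unfolding of_bool_conj[symmetric] sum_of_bool_eq_card 1 sym[of _ y] by simp
    then show ?thesis
      using 1 irr[of x] n by (simp add: cover_degree[OF cov])
  next
    case 2
    then have "\<not> (E x z \<and> E z y)" for z
      using uniq[of z x y] sym[of x z] by blast
    then have "?N y = 0" by (intro sum.neutral) auto
    moreover have "\<not> E x y" using 2 fib[of x y] by blast
    ultimately show ?thesis using 2 by (simp only:) simp
  next
    case 3
    then have "x \<noteq> y" by blast
    then show ?thesis using N_nonadj[OF 3] 3 by (simp only:) simp
  next
    case 4
    \<comment> \<open>Of the \<open>n - 1\<close> neighbours of \<open>x\<close>, all but the one in
      the fibre of \<open>y\<close> have exactly one neighbour in that fibre, which gives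
      \<open>n - 2\<close> walks.\<close>
    have "(\<Sum>y'\<in>UNIV. ?N y' * of_bool (p y' = p y)) =
        (\<Sum>z\<in>UNIV. of_bool (E x z) * (\<Sum>y'\<in>UNIV. of_bool (E z y') * of_bool (p y' = p y)))"
      unfolding sum_distrib_left sum_distrib_right mult.assoc by (rule sum.swap)
    also have "\<dots> = (\<Sum>z\<in>UNIV. of_bool (E x z) - of_bool (E x z) * of_bool (p z = p y))"
      unfolding cover_neighbours_in_fibre[OF cov] by (intro sum.cong) auto
    also have "\<dots> = real n - 2"
      unfolding sum_subtractf cover_neighbours_in_fibre[OF cov] cover_degree[OF cov]
      using fib[OF 4] n by auto
    finally have 1: "(\<Sum>y'\<in>UNIV. ?N y' * of_bool (p y' = p y)) = real n - 2" .
    \<comment> \<open>The only neighbour of \<open>x\<close> in the fibre of \<open>y\<close> is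
      \<open>y\<close>, so each of the other vertices there accounts for \<open>c\<close>
      walks.\<close>
    have "?N y' * of_bool (p y' = p y) =
        (?N y - real c) * of_bool (y' = y) + real c * of_bool (p y' = p y)" for y'
    proof (cases "y' = y")
      case False
      show ?thesis
      proof (cases "p y' = p y")
        case True
        then have "\<not> E x y'" using uniq[OF 4, of y'] False by auto
        then have "?N y' = real c" using fib[OF 4] True by (intro N_nonadj) simp_all
        then show ?thesis using True False by (simp only:) simp
      qed (use False in simp)
    qed simp
    then have "real n - 2 = (?N y - real c) * (\<Sum>y'\<in>UNIV. of_bool (y' = y))
        + real c * (\<Sum>y'\<in>UNIV. of_bool (p y' = p y))"
      unfolding 1[symmetric] sum_distrib_left sum.distrib[symmetric]
      by (intro sum.cong) (rule refl)
    moreover have "(\<Sum>y'\<in>UNIV. of_bool (p y' = p y)) = real r"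
      using cov by (simp only: sum_of_bool_eq_card cover_of_complete_def)
    moreover have "(\<Sum>y'\<in>UNIV. of_bool (y' = y)) = (1 :: real)"
      unfolding sum_of_bool_eq_card by simp
    ultimately have "?N y = real n - 2 - real c * real r + real c"
      by (simp only: mult_1_right)
    then show ?thesis
      using 4 irr[of x] fib[OF 4] by (cases "x = y") (simp_all add: drackn_delta_def mult.commute)
  qed
qed

section \<open>Kernel operators and the dimension of an eigenspace\<close>

lemma sum_Basis_vec:
  fixes g :: "real^'n \<Rightarrow> real"
  shows "(\<Sum>b\<in>Basis. g b) = (\<Sum>i\<in>UNIV. g (axis i 1))"
proof -
  have Basis: "(Basis :: (real^'n) set) = range (\<lambda>i. axis i 1)"
    by (auto simp: Basis_vec_def)
  have "inj (\<lambda>i::'n. axis i (1::real))"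
    by (auto simp: inj_on_def axis_eq_axis)
  then show ?thesis unfolding Basis by (subst sum.reindex) simp_all
qed

lemma sum_of_bool_eq_mult:
  "(\<Sum>w\<in>UNIV. s * (of_bool (u = w) * f w)) = s * (f (u :: 'a::finite) :: real)"
proof -
  have "(\<Sum>w\<in>UNIV. s * (of_bool (u = w) * f w)) = (\<Sum>w\<in>UNIV. if w = u then s * f u else 0)"
    by (intro sum.cong) auto
  then show ?thesis by simp
qed

lemma sum_kernel_compose:
  "(\<Sum>z\<in>A. f z * (\<Sum>w\<in>B. g z w * h w)) = (\<Sum>w\<in>B. (\<Sum>z\<in>A. f z * g z w) * (h w :: real))"
  unfolding sum_distrib_left sum_distrib_right mult.assoc by (rule sum.swap)

lemma kernel_inner_symmetric:
  fixes k :: "'v::finite \<Rightarrow> 'v \<Rightarrow> real"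
  assumes "\<And>u w. k u w = k w u"
  shows "(\<chi> u. \<Sum>w\<in>UNIV. k u w * x $ w) \<bullet> y = x \<bullet> (\<chi> u. \<Sum>w\<in>UNIV. k u w * y $ w)"
proof -
  have "(\<Sum>u\<in>UNIV. \<Sum>w\<in>UNIV. k u w * x $ w * y $ u) = (\<Sum>w\<in>UNIV. \<Sum>u\<in>UNIV. k u w * x $ w * y $ u)"
    by (rule sum.swap)
  then show ?thesis
    by (simp add: inner_vec_def sum_distrib_left sum_distrib_right assms mult_ac)
qed

text \<open>On the vectors whose sum over each fibre vanishes the adjacency operator \<open>A\<close> satisfies
  \<open>(A - a) (A - b) = 0\<close>, so \<open>A - b\<close>, corrected by multiples of the all-ones matrix and of the
  fibre matrix, is \<open>a - b\<close> times the projection onto the eigenspace of \<open>a\<close>.\<close>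

lemma drackn_multiplicity:
  fixes p :: "'v::finite \<Rightarrow> 'n::finite"
  assumes X: "drackn n r c E p"
    and ab: "a + b = drackn_delta n r c" "a * b = 1 - real n"
    and a: "a \<noteq> - 1" "a \<noteq> real n - 1"
  shows "(a - b) * real (eigenvalue_multiplicity E a) = - b * real n * (real r - 1)"
proof -
  have cov: "cover_of_complete E p r" and n: "CARD('n) = n" and r: "real r \<noteq> 0"
    using X unfolding drackn_def by simp_all
  note sym = cover_symmetric[OF cov]
  \<comment> \<open>\<open>e\<close> and \<open>q\<close> are the entries of the adjacency and the
    fibre matrix, \<open>A\<close> and \<open>F\<close> the corresponding operators on functions,
    and \<open>J\<close> the total sum.\<close>
  define e where "e u w = (of_bool (E u w) :: real)" for u w
  define q where "q u w = (of_bool (p u = p w) :: real)" for u w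
  define A where "A x u = (\<Sum>w\<in>UNIV. e u w * x w)" for x u
  define F where "F x u = (\<Sum>w\<in>UNIV. q u w * x w)" for x u
  define J where "J x = (\<Sum>w\<in>UNIV. x w :: real)" for x :: "'v \<Rightarrow> real"
  have e_sym: "e u w = e w u" for u w using sym by (simp add: e_def)
  have q_sym: "q u w = q w u" for u w by (simp add: q_def eq_commute)
  have deg: "(\<Sum>w\<in>UNIV. e u w) = real n - 1" for u
    unfolding e_def n[symmetric] by (rule cover_degree[OF cov])
  \<comment> \<open>A vertex has one neighbour in each fibre other than its own, so the product of
    the adjacency and fibre matrices is the all-ones matrix minus the fibre matrix.\<close>
  have eq: "(\<Sum>z\<in>UNIV. e u z * q z w) = 1 - q u w" for u w
    unfolding e_def q_def cover_neighbours_in_fibre[OF cov] by (auto simp: of_bool_def)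
  have ee: "(\<Sum>z\<in>UNIV. e u z * e z w) = (real n - 1) * of_bool (u = w)
      + drackn_delta n r c * e u w + real c * (1 - q u w)" for u w
    unfolding e_def q_def drackn_common_neighbours[OF X] by (simp add: of_bool_def)
  have AA: "A (A x) u = (real n - 1) * x u + drackn_delta n r c * A x u + real c * (J x - F x u)" for x u
    unfolding A_def sum_kernel_compose ee J_def F_def
    by (simp add: distrib_right left_diff_distrib right_diff_distrib sum.distrib sum_subtractf
        sum_of_bool_eq_mult sum_distrib_left[symmetric] mult.assoc)
  have AF: "A (F x) u = J x - F x u" for x u
    unfolding A_def F_def sum_kernel_compose eq J_def by (simp add: left_diff_distrib sum_subtractf)
  have FA: "F (A x) u = J x - F x u" for x u
  proof -
    have "(\<Sum>z\<in>UNIV. q u z * e z w) = 1 - q u w" for w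
      using eq[of w u] by (simp add: mult.commute[of "q _ _"] e_sym[of w] q_sym[of _ u])
    then show ?thesis
      unfolding A_def F_def sum_kernel_compose J_def by (simp add: left_diff_distrib sum_subtractf)
  qed
  have AJ: "A (\<lambda>_. s) u = (real n - 1) * s" for s u
    unfolding A_def sum_distrib_right[symmetric] deg ..
  have JA: "J (A x) = (real n - 1) * J x" for x
  proof -
    have "(\<Sum>z\<in>UNIV. e z w) = real n - 1" for w
      unfolding e_sym[of _ w] by (rule deg)
    then show ?thesis
      unfolding J_def A_def
      by (subst sum.swap) (simp only: sum_distrib_right[symmetric] sum_distrib_left)
  qed
  \<comment> \<open>The coefficients make \<open>Q\<close> annihilate all vectors constant on
    fibres: there \<open>F\<close> acts as \<open>r\<close>, while \<open>A\<close> acts as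
    \<open>-1\<close> on those with total sum zero and as \<open>n - 1\<close> on constant
    vectors.\<close>
  define k where "k u w = e u w - b * of_bool (u = w) - 1 / r + (1 + b) / r * q u w" for u w
  define Q :: "real^'v \<Rightarrow> real^'v" where "Q x = (\<chi> u. \<Sum>w\<in>UNIV. k u w * x $ w)" for x
  define V where "V = {x :: real^'v. adjacency_matrix E *v x = a *\<^sub>R x}"
  have Q: "Q x $ u = A (($) x) u - b * x $ u - 1 / r * J (($) x) + (1 + b) / r * F (($) x) u" for x u
    unfolding Q_def k_def A_def J_def F_def
    by (simp add: distrib_right left_diff_distrib sum.distrib sum_subtractf
        sum_of_bool_eq_mult sum_distrib_left[symmetric] sum_divide_distrib[symmetric] mult.assoc)
  have V: "x \<in> V \<longleftrightarrow> (\<forall>u. A (($) x) u = a * x $ u)" for x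
    by (simp add: V_def vec_eq_iff adjacency_matrix_def matrix_vector_mult_def A_def e_def)
  have A_lin: "A (\<lambda>u. f u - b * g u - s + t * h u) u = A f u - b * A g u - (real n - 1) * s + t * A h u"
    for f g h s t u
    unfolding AJ[of s u, symmetric]
    unfolding A_def by (simp add: algebra_simps sum.distrib sum_subtractf sum_distrib_left)
  have "(\<Sum>i\<in>Basis. Q i \<bullet> i) = (a - b) * real (dim V)"
  proof (rule trace_scaled_projection)
    show "subspace V"
      by (auto simp: V_def subspace_def matrix_vector_right_distrib scaleR_right_distrib
          matrix_vector_mult_scaleR)
    show "Q x \<bullet> y = x \<bullet> Q y" for x y
      unfolding Q_def by (rule kernel_inner_symmetric) (auto simp: k_def e_sym q_sym)
    show "Q x \<in> V" for x
      unfolding V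
    proof
      fix u
      define y where "y = ($) x"
      have Qx: "($) (Q x) = (\<lambda>u. A y u - b * y u - 1 / r * J y + (1 + b) / r * F y u)"
        by (rule ext) (simp add: Q y_def)
      have "A (($) (Q x)) u = (real n - 1) * y u + drackn_delta n r c * A y u + real c * (J y - F y u)
          - b * A y u - (real n - 1) * (1 / r * J y) + (1 + b) / r * (J y - F y u)"
        unfolding Qx A_lin AA AF ..
      also have "\<dots> = a * (A y u - b * y u - 1 / r * J y + (1 + b) / r * F y u)"
      proof -
        \<comment> \<open>With \<open>i\<close> for the inverse of \<open>r\<close> and with
          \<open>c\<close> and \<open>n\<close> expressed through \<open>a\<close>, \<open>b\<close>
          and \<open>i\<close>, the claim becomes a polynomial identity.\<close>
        define i where "i = 1 / real r"
        have 1: "real c = (real n - 2 - a - b) * i"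
          using ab(1) r by (simp add: drackn_delta_def i_def field_simps)
        have 2: "real n = 1 - a * b" using ab(2) by simp
        have 3: "(1 + b) / real r = (1 + b) * i" by (simp add: i_def)
        show ?thesis
          unfolding 1 2 3 ab(1)[symmetric] i_def[symmetric] by Groebner_Basis.algebra
      qed
      finally show "A (($) (Q x)) u = a * Q x $ u"
        by (simp only: Qx)
    qed
    show "Q x = (a - b) *\<^sub>R x" if "x \<in> V" for x
    proof -
      define y where "y = ($) x"
      have Ay: "A y = (\<lambda>u. a * y u)" using that V y_def by auto
      \<comment> \<open>Since \<open>a \<noteq> n - 1\<close>, the total sum of an eigenvector
        vanishes; since \<open>a \<noteq> - 1\<close>, so do its fibre sums. The correction terms of
        \<open>Q\<close> then disappear.\<close>
      have "J (A y) = a * J y" "F (A y) u = a * F y u" for u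
        unfolding Ay J_def F_def by (simp_all add: sum_distrib_left mult_ac)
      then have "(real n - 1 - a) * J y = 0" "(1 + a) * F y u = J y" for u
        using JA[of y] FA[of y u] by (simp_all add: algebra_simps)
      then have "J y = 0" "F y u = 0" for u using a by auto
      then show ?thesis
        by (simp add: vec_eq_iff Q y_def[symmetric] Ay left_diff_distrib)
    qed
  qed
  \<comment> \<open>The \<open>n r\<close> diagonal entries of \<open>Q\<close> agree, as the
    adjacency matrix has zero diagonal and the fibre matrix unit diagonal.\<close>
  moreover have "(\<Sum>i\<in>Basis. Q i \<bullet> i) = real n * real r * (- b - 1 / r + (1 + b) / r)"
  proof -
    have "Q (axis i 1) \<bullet> axis i 1 = - b - 1 / r + (1 + b) / r" for i
    proof -
      have "(\<Sum>w\<in>UNIV. k i w * axis i 1 $ w) = (\<Sum>w\<in>UNIV. if w = i then k i i else 0)"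
        by (intro sum.cong) (auto simp: axis_def)
      then show ?thesis
        using cover_fibre_not_adjacent[OF cov, of i i]
        by (auto simp: Q_def inner_axis k_def e_def q_def)
    qed
    then show ?thesis
      by (simp add: sum_Basis_vec cover_card[OF cov] n)
  qed
  moreover have "real n * real r * (- b - 1 / r + (1 + b) / r) = - b * real n * (real r - 1)"
    using r by (simp add: field_simps)
  ultimately show ?thesis
    by (simp add: eigenvalue_multiplicity_def V_def)
qed

subsection \<open>The character matrix of an abelian drackn\<close>

locale presented_drackn =
  fixes n r c :: nat and E :: "'v::finite \<Rightarrow> 'v \<Rightarrow> bool" and p :: "'v \<Rightarrow> 'n::finite"
    and f :: "'n \<Rightarrow> 'n \<Rightarrow> nat \<Rightarrow> nat"
  assumes drackn: "drackn n r c E p" and presentation: "abelian_presentation E p r f"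
begin

abbreviation G where "G \<equiv> arc_group r f"

lemma comm_group_G: "comm_group G"
  using presentation by (simp add: abelian_presentation_def)

lemma group_G: "group G"
  using comm_group_G by (rule comm_group.axioms(2))

lemma arc_function_f: "arc_function r f"
  using presentation unfolding abelian_presentation_def normalized_arc_function_def by blast

lemma arc_in_sym_group: "u \<noteq> v \<Longrightarrow> f u v \<in> carrier (sym_group r)"
  using arc_function_f unfolding arc_function_def by blast

lemma mult_G: "x \<otimes>\<^bsub>G\<^esub> y = x \<circ> y"
  by (simp add: arc_group_def sym_group_def)

lemma one_G: "\<one>\<^bsub>G\<^esub> = id"
  by (simp add: arc_group_def sym_group_def)

lemma arc_in_G: "u \<noteq> v \<Longrightarrow> f u v \<in> carrier G"
  unfolding arc_group_def by (auto intro: generate.incl)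

lemma arc_reverse:
  assumes "u \<noteq> v"
  shows "f v u \<circ> f u v = id"
proof -
  have "f v u = inv\<^bsub>sym_group r\<^esub> (f u v)"
    using arc_function_f assms unfolding arc_function_def by blast
  then show ?thesis
    using group.l_inv[OF sym_group_is_group arc_in_sym_group[OF assms]]
    by (simp only: sym_group_mult sym_group_one)
qed

lemma carrier_G_permutes: "g \<in> carrier G \<Longrightarrow> g permutes {1..r}"
proof -
  assume "g \<in> carrier G"
  then have "g \<in> generate (sym_group r) {f u v | u v. u \<noteq> v}"
    by (simp add: arc_group_def)
  moreover have "{f u v | u v. u \<noteq> v} \<subseteq> carrier (sym_group r)"
    using arc_in_sym_group by blast
  ultimately have "g \<in> carrier (sym_group r)"
    using group.generate_in_carrier[OF sym_group_is_group] by blast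
  then show ?thesis by (simp add: sym_group_carrier)
qed

lemma carrier_G_eqI:
  assumes "g \<in> carrier G" "h \<in> carrier G" "i \<in> {1..r}" "g i = h i"
  shows "g = h"
proof -
  have "h i \<in> {1..r}"
    using carrier_G_permutes[OF assms(2)] assms(3) by (simp only: permutes_in_image)
  then have "\<exists>!g. g \<in> carrier G \<and> g i = h i"
    using presentation assms(3) unfolding abelian_presentation_def by blast
  then show ?thesis using assms by blast
qed

lemma r_ge_2: "2 \<le> r" and n_ge_2: "2 \<le> n" and card_n: "CARD('n) = n"
  using drackn by (simp_all add: drackn_def)

text \<open>By regularity, evaluation at the base point 1 identifies group elements with points;
  this gives the group order.\<close>

lemma bij_betw_carrier_G: "bij_betw (\<lambda>g. g 1) (carrier G) {1..r}"
  unfolding bij_betw_def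
proof
  have 1: "1 \<in> {1..r}" using r_ge_2 by simp
  show "inj_on (\<lambda>g. g 1) (carrier G)"
    by (rule inj_onI) (rule carrier_G_eqI[OF _ _ 1])
  show "(\<lambda>g. g 1) ` carrier G = {1..r}"
  proof
    show "(\<lambda>g. g 1) ` carrier G \<subseteq> {1..r}"
      using permutes_in_image[OF carrier_G_permutes] 1 by blast
    show "{1..r} \<subseteq> (\<lambda>g. g 1) ` carrier G"
    proof
      fix j assume "j \<in> {1..r}"
      then have "\<exists>!g. g \<in> carrier G \<and> g 1 = j"
        using presentation 1 unfolding abelian_presentation_def by blast
      then show "j \<in> (\<lambda>g. g 1) ` carrier G" by blast
    qed
  qed
qed

lemma card_G: "card (carrier G) = r"
  using bij_betw_same_card[OF bij_betw_carrier_G] by simp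

lemma finite_G: "finite (carrier G)"
  using bij_betw_finite[OF bij_betw_carrier_G] by simp

text \<open>Let \<open>x\<close> be the vertex labelled 1 over \<open>u\<close>, and
  \<open>y\<close> the vertex labelled \<open>g 1\<close> over \<open>v\<close>. A group element is
  determined by its value at 1, so the walks through \<open>w\<close> whose arc values compose to
  \<open>g\<close> correspond to the common neighbours of \<open>x\<close> and \<open>y\<close>, and
  \<open>x\<close> and \<open>y\<close> are adjacent exactly if \<open>g = f u v\<close>.\<close>

lemma card_intermediate:
  assumes uv: "u \<noteq> v" and g: "g \<in> carrier G"
  shows "real (card {w. w \<noteq> u \<and> w \<noteq> v \<and> f w v \<circ> f u w = g}) =
    drackn_delta n r c * of_bool (g = f u v) + real c" (is "real (card ?W) = _")
proof -
  have cov: "cover_of_complete E p r"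
    using drackn unfolding drackn_def by simp
  obtain lab where lab: "\<And>u. bij_betw lab {x. p x = u} {1..r}"
    and E: "\<And>x y. E x y \<longleftrightarrow> p x \<noteq> p y \<and> lab y = f (p x) (p y) (lab x)"
    using presentation unfolding abelian_presentation_def determined_by_def by blast
  have ex: "\<exists>x. p x = u \<and> lab x = i" if "i \<in> {1..r}" for u i
  proof -
    have "i \<in> lab ` {x. p x = u}" using bij_betw_imp_surj_on[OF lab[of u]] that by simp
    then show ?thesis by blast
  qed
  have lab_inj: "z = z'" if "p z = p z'" "lab z = lab z'" for z z'
    using inj_onD[OF bij_betw_imp_inj_on[OF lab[of "p z'"]]] that by blast
  have lab_range: "lab z \<in> {1..r}" for z
    using bij_betwE[OF lab[of "p z"]] by simp
  obtain x where x: "p x = u" "lab x = 1" using ex[of 1 u] r_ge_2 by auto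
  have g1: "g 1 \<in> {1..r}" using bij_betw_carrier_G g by (auto simp: bij_betw_def)
  obtain y where y: "p y = v" "lab y = g 1" using ex[OF g1] by blast
  have walk: "f w v \<circ> f u w \<in> carrier G" if "w \<noteq> u" "w \<noteq> v" for w
    using monoid.m_closed[OF group.is_monoid[OF group_G] arc_in_G arc_in_G, of w v u w] that
    by (simp add: mult_G)
  have one: "1 \<in> {1..r}" using r_ge_2 by simp
  have "bij_betw p {z. E x z \<and> E z y} ?W"
    unfolding bij_betw_def
  proof
    show "inj_on p {z. E x z \<and> E z y}"
      using E by (intro inj_onI lab_inj) auto
    show "p ` {z. E x z \<and> E z y} = ?W"
    proof
      show "p ` {z. E x z \<and> E z y} \<subseteq> ?W"
      proof
        fix w assume "w \<in> p ` {z. E x z \<and> E z y}"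
        then obtain z where z: "w = p z" "E x z" "E z y" by blast
        then have w: "w \<noteq> u" "w \<noteq> v" "(f w v \<circ> f u w) 1 = g 1"
          using x y E by auto
        moreover have "f w v \<circ> f u w = g"
          using carrier_G_eqI[OF walk g one] w by blast
        ultimately show "w \<in> ?W" by blast
      qed
      show "?W \<subseteq> p ` {z. E x z \<and> E z y}"
      proof
        fix w assume w: "w \<in> ?W"
        have "f u w 1 \<in> {1..r}"
        proof -
          have "u \<noteq> w" using w by blast
          from permutes_in_image[OF carrier_G_permutes[OF arc_in_G[OF this]], of 1] one
          show ?thesis by simp
        qed
        then obtain z where z: "p z = w" "lab z = f u w 1" using ex by blast
        have "(f w v \<circ> f u w) 1 = g 1" using w by simp
        then have "E x z" "E z y" using w x y z unfolding E by auto
        then show "w \<in> p ` {z. E x z \<and> E z y}" using z(1) by blast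
      qed
    qed
  qed
  then have "card ?W = card {z. E x z \<and> E z y}"
    by (simp add: bij_betw_same_card)
  moreover have "E x y \<longleftrightarrow> g = f u v"
    using carrier_G_eqI[OF g arc_in_G[OF uv] one] x y uv unfolding E by auto
  moreover have "x \<noteq> y" using x y uv by blast
  ultimately show ?thesis
    using drackn_common_neighbours[OF drackn, of x y] x y uv
    unfolding of_bool_conj[symmetric] sum_of_bool_eq_card by simp
qed

context
  fixes \<phi> assumes \<phi>: "nontrivial_character G \<phi>"
begin

lemma linear: "linear_character G \<phi>"
  using \<phi> by (simp add: nontrivial_character_def)

text \<open>Off the diagonal the intermediate vertices \<open>w\<close> are grouped by the group
  element of the walk through \<open>w\<close>. By \<open>card_intermediate\<close> each group has
  size \<open>c\<close>, with an extra \<delta> at \<open>f u v\<close>; the constant part cancels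
  because a non-trivial character sums to zero.\<close>

lemma character_matrix_square:
  "(\<Sum>w\<in>UNIV. character_matrix f \<phi> $ u $ w * character_matrix f \<phi> $ w $ v) =
    of_real (drackn_delta n r c) * character_matrix f \<phi> $ u $ v
      + (if u = v then of_real (real n - 1) else 0)"
proof -
  let ?W = "{w. w \<noteq> u \<and> w \<noteq> v}"
  have "(\<Sum>w\<in>UNIV. character_matrix f \<phi> $ u $ w * character_matrix f \<phi> $ w $ v) =
      (\<Sum>w\<in>?W. character_matrix f \<phi> $ u $ w * character_matrix f \<phi> $ w $ v)"
    by (intro sum.mono_neutral_right) (auto simp: character_matrix_def)
  also have "\<dots> = (\<Sum>w\<in>?W. \<phi> (f w v \<circ> f u w))"
  proof (intro sum.cong refl)
    fix w assume "w \<in> ?W"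
    then have "\<phi> (f w v \<otimes>\<^bsub>G\<^esub> f u w) = \<phi> (f w v) * \<phi> (f u w)"
      by (intro linear_character_mult[OF linear] arc_in_G) auto
    then show "character_matrix f \<phi> $ u $ w * character_matrix f \<phi> $ w $ v = \<phi> (f w v \<circ> f u w)"
      using \<open>w \<in> ?W\<close> by (auto simp: character_matrix_def mult_G mult.commute)
  qed
  also have "\<dots> = of_real (drackn_delta n r c) * character_matrix f \<phi> $ u $ v
      + (if u = v then of_real (real n - 1) else 0)"
  proof (cases "u = v")
    case True
    \<comment> \<open>A walk from \<open>u\<close> to \<open>w\<close> and back composes to the
      identity, so each of the \<open>n - 1\<close> terms is 1.\<close>
    have "(\<Sum>w\<in>?W. \<phi> (f w v \<circ> f u w)) = (\<Sum>w\<in>?W. 1)"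
      using linear_character_one[OF group_G linear]
      by (intro sum.cong refl) (auto simp: True arc_reverse one_G)
    also have "\<dots> = of_real (real n - 1)"
    proof -
      have "?W = UNIV - {v}" using True by blast
      then show ?thesis using card_n n_ge_2 by (simp add: of_nat_diff)
    qed
    finally show ?thesis using True by (simp add: character_matrix_def)
  next
    case False
    have "(\<Sum>w\<in>?W. \<phi> (f w v \<circ> f u w)) =
        (\<Sum>g\<in>carrier G. \<Sum>w\<in>{w \<in> ?W. f w v \<circ> f u w = g}. \<phi> (f w v \<circ> f u w))"
    proof (rule sum.group[symmetric])
      show "(\<lambda>w. f w v \<circ> f u w) ` ?W \<subseteq> carrier G"
      proof
        fix g assume "g \<in> (\<lambda>w. f w v \<circ> f u w) ` ?W"
        then obtain w where "g = f w v \<otimes>\<^bsub>G\<^esub> f u w" "w \<noteq> v" "u \<noteq> w"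
          unfolding mult_G by blast
        then show "g \<in> carrier G"
          using monoid.m_closed[OF group.is_monoid[OF group_G]] arc_in_G by blast
      qed
    qed (simp_all add: finite_G)
    also have "\<dots> = (\<Sum>g\<in>carrier G. of_real (real (card {w. w \<noteq> u \<and> w \<noteq> v \<and> f w v \<circ> f u w = g})) * \<phi> g)"
      by (intro sum.cong refl) (simp add: conj_assoc)
    also have "\<dots> = (\<Sum>g\<in>carrier G. of_real (drackn_delta n r c) * (if g = f u v then \<phi> g else 0)
        + of_real (real c) * \<phi> g)"
      by (intro sum.cong refl) (simp add: card_intermediate[OF False] distrib_right)
    also have "\<dots> = of_real (drackn_delta n r c) * \<phi> (f u v)"
      using arc_in_G[OF False] finite_G sum_nontrivial_character[OF group_G finite_G \<phi>]
      by (simp add: sum.distrib flip: sum_distrib_left)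
    finally show ?thesis using False by (simp add: character_matrix_def)
  qed
  finally show ?thesis .
qed

text \<open>Reversing an arc inverts the character value, and for values of modulus 1 inversion is
  conjugation.\<close>

lemma character_matrix_adjoint: "character_matrix f \<phi> $ v $ u = cnj (character_matrix f \<phi> $ u $ v)"
proof (cases "u = v")
  case False
  have inverse: "\<phi> (f v u) * \<phi> (f u v) = 1"
    using linear_character_mult[OF linear arc_in_G arc_in_G, of v u u v] False
      linear_character_one[OF group_G linear]
    by (simp add: mult_G arc_reverse one_G)
  have norm: "\<phi> (f u v) * cnj (\<phi> (f u v)) = 1"
    using cmod_linear_character[OF group_G finite_G linear arc_in_G[OF False]]
      complex_norm_square[of "\<phi> (f u v)"] by simp
  have "\<phi> (f v u) = \<phi> (f v u) * (\<phi> (f u v) * cnj (\<phi> (f u v)))"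
    by (simp only: norm mult_1_right)
  also have "\<dots> = cnj (\<phi> (f u v))"
    by (simp only: mult.assoc[symmetric] inverse mult_1_left)
  finally have "\<phi> (f v u) = cnj (\<phi> (f u v))" .
  then show ?thesis using False by (simp add: character_matrix_def)
qed (simp add: character_matrix_def)

lemma cmod_character_matrix: "u \<noteq> v \<Longrightarrow> cmod (character_matrix f \<phi> $ u $ v) = 1"
  using cmod_linear_character[OF group_G finite_G linear arc_in_G] by (simp add: character_matrix_def)

end

end

text \<open>\<theta> and \<tau> are the roots of \<open>X^2 - \<delta> X - (n - 1)\<close>. The
  signs and inequalities keep both away from \<open>n - 1\<close> and \<open>-1\<close>, as
  \<open>drackn_multiplicity\<close> requires.\<close>

lemma drackn_eigenvalues:
  assumes "drackn n r c E p"
  shows "drackn_theta n r c + drackn_tau n r c = drackn_delta n r c"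
    and "drackn_theta n r c * drackn_tau n r c = 1 - real n"
    and "0 < drackn_theta n r c" and "drackn_tau n r c < 0"
    and "drackn_theta n r c \<noteq> real n - 1" and "drackn_tau n r c \<noteq> - 1"
proof -
  define D where "D = (drackn_delta n r c)\<^sup>2 + 4 * (real n - 1)"
  have n: "2 \<le> n" and rc: "0 < real r * real c"
    using assms by (simp_all add: drackn_def)
  have sq: "(sqrt D)\<^sup>2 = D" using n by (simp add: D_def)
  have "sqrt ((drackn_delta n r c)\<^sup>2) < sqrt D"
    unfolding D_def using n by (intro real_sqrt_less_mono) simp
  then have less: "\<bar>drackn_delta n r c\<bar> < sqrt D" by simp
  show sum: "drackn_theta n r c + drackn_tau n r c = drackn_delta n r c"
    by (simp add: drackn_theta_def drackn_tau_def field_simps)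
  have "4 * ((a + b) / 2 * ((a - b) / 2)) = a\<^sup>2 - b\<^sup>2" for a b :: real
    by (simp add: power2_eq_square field_simps)
  then have "4 * (drackn_theta n r c * drackn_tau n r c) = (drackn_delta n r c)\<^sup>2 - (sqrt D)\<^sup>2"
    unfolding drackn_theta_def drackn_tau_def D_def[symmetric] .
  then show prod: "drackn_theta n r c * drackn_tau n r c = 1 - real n"
    unfolding sq by (simp add: D_def)
  show pos: "0 < drackn_theta n r c" and "drackn_tau n r c < 0"
    using less unfolding drackn_theta_def drackn_tau_def D_def[symmetric] by simp_all
  show tau: "drackn_tau n r c \<noteq> - 1"
  proof
    \<comment> \<open>Then the product gives \<open>\<theta> = n - 1\<close> and the sum gives
      \<open>\<delta> = n - 2\<close>, that is, \<open>rc = 0\<close>.\<close>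
    assume t: "drackn_tau n r c = - 1"
    then have "drackn_theta n r c = real n - 1" using prod by simp
    then have "drackn_delta n r c = real n - 2" using sum t by simp
    then show False using rc by (auto simp: drackn_delta_def)
  qed
  show "drackn_theta n r c \<noteq> real n - 1"
  proof
    assume t: "drackn_theta n r c = real n - 1"
    have "(real n - 1) * (drackn_tau n r c + 1) = 0"
      using prod unfolding t by (simp add: distrib_left)
    then show False using tau n by (simp add: add_eq_0_iff)
  qed
qed

lemma drackn_reduced_multiplicities:
  fixes p :: "'v::finite \<Rightarrow> 'n::finite"
  assumes X: "drackn n r c E p"
  defines "\<theta> \<equiv> drackn_theta n r c" and "\<tau> \<equiv> drackn_tau n r c"
  shows "(\<theta> - \<tau>) * (real (eigenvalue_multiplicity E \<theta>) / (real r - 1)) = - \<tau> * real n"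
    and "(\<theta> - \<tau>) * (real (eigenvalue_multiplicity E \<tau>) / (real r - 1)) = \<theta> * real n"
proof -
  note ev = drackn_eigenvalues[OF X, folded \<theta>_def \<tau>_def]
  have n: "2 \<le> n" and r: "real r - 1 \<noteq> 0" using X by (auto simp: drackn_def)
  have "(\<theta> - \<tau>) * real (eigenvalue_multiplicity E \<theta>) = - \<tau> * real n * (real r - 1)"
    by (rule drackn_multiplicity[OF X ev(1,2)]) (use ev(3,5) in simp_all)
  then show "(\<theta> - \<tau>) * (real (eigenvalue_multiplicity E \<theta>) / (real r - 1)) = - \<tau> * real n"
    using r by (simp add: divide_simps)
  have "(\<tau> - \<theta>) * real (eigenvalue_multiplicity E \<tau>) = - \<theta> * real n * (real r - 1)"
    by (rule drackn_multiplicity[OF X])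
      (use ev(1,2,4,6) n in \<open>simp_all add: add.commute mult.commute\<close>)
  then have "(\<theta> - \<tau>) * real (eigenvalue_multiplicity E \<tau>) = \<theta> * real n * (real r - 1)"
    by (simp add: algebra_simps)
  then show "(\<theta> - \<tau>) * (real (eigenvalue_multiplicity E \<tau>) / (real r - 1)) = \<theta> * real n"
    using r by (simp add: divide_simps)
qed

lemma real_choose_two: "real ((d + 1) choose 2) = real d * (real d + 1) / 2"
proof (induction d)
  case (Suc d)
  have "(Suc d + 1) choose 2 = (d + 1) + ((d + 1) choose 2)"
    by (simp add: numeral_2_eq_2)
  then show ?case using Suc by (simp add: field_simps)
qed simp

section \<open>Gram matrices attached to a character and a root\<close>

context presented_drackn
begin

context
  fixes \<phi> and \<eta> \<omega> :: real
  assumes \<phi>: "nontrivial_character G \<phi>"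
    and roots: "\<eta> + \<omega> = drackn_delta n r c" "\<eta> * \<omega> = 1 - real n"
begin

text \<open>\<eta> is the root defining the lines and \<omega> the other one. Constraining them only
  by their sum and product treats both sets of lines at once.\<close>

abbreviation gram where "gram \<equiv> mat 1 - (1 / \<eta>) *\<^sub>R character_matrix f \<phi>"

lemma root_nonzero: "\<eta> \<noteq> 0"
  using roots(2) n_ge_2 by auto

lemma gram_entry: "gram $ u $ v = (if u = v then 1 else 0) - of_real (1 / \<eta>) * character_matrix f \<phi> $ u $ v"
  by (simp add: mat_def) (simp add: scaleR_conv_of_real)

lemma gram_diagonal: "gram $ u $ u = 1"
  unfolding gram_entry by (simp add: character_matrix_def)

lemma gram_adjoint: "gram $ v $ u = cnj (gram $ u $ v)"
  unfolding gram_entry character_matrix_adjoint[OF \<phi>, of v u] by simp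

lemma cmod_gram: "u \<noteq> v \<Longrightarrow> cmod (gram $ u $ v) = 1 / \<bar>\<eta>\<bar>"
  unfolding gram_entry by (simp add: norm_divide cmod_character_matrix[OF \<phi>])

text \<open>By \<open>character_matrix_square\<close> and the root relations,
  \<open>(S - \<eta>) (S - \<omega>) = 0\<close>. The Gram matrix is proportional to
  \<open>S - \<eta>\<close>, so its square is a multiple of itself.\<close>

lemma gram_square: "(\<Sum>w\<in>UNIV. gram $ v $ w * gram $ w $ u) = of_real (1 - \<omega> / \<eta>) * gram $ v $ u"
proof -
  define s where "s = 1 / \<eta>"
  define S where "S u v = character_matrix f \<phi> $ u $ v" for u v
  define I where "I u v = (if u = v then 1 else 0 :: complex)" for u v :: 'n
  have g: "gram $ u $ v = I u v - of_real s * S u v" for u v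
    by (simp only: gram_entry s_def S_def I_def)
  have I: "(\<Sum>w\<in>UNIV. I v w * h w) = h v" "(\<Sum>w\<in>UNIV. h w * I w u) = h u" for h
    by (simp_all add: I_def if_distrib[of "\<lambda>x. x * _"] if_distrib[of "\<lambda>x. _ * x"] cong: if_cong)
  have S: "(\<Sum>w\<in>UNIV. S v w * S w u) = of_real (drackn_delta n r c) * S v u + of_real (real n - 1) * I v u"
    unfolding S_def character_matrix_square[OF \<phi>] by (simp add: I_def)
  have "(\<Sum>w\<in>UNIV. gram $ v $ w * gram $ w $ u) = (\<Sum>w\<in>UNIV. I v w * I w u)
      - (\<Sum>w\<in>UNIV. I v w * (of_real s * S w u)) - of_real s * (\<Sum>w\<in>UNIV. S v w * I w u)
      + of_real (s\<^sup>2) * (\<Sum>w\<in>UNIV. S v w * S w u)"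
    unfolding g sum_distrib_left sum_subtractf[symmetric] sum.distrib[symmetric]
    by (intro sum.cong refl) (simp add: algebra_simps power2_eq_square)
  also have "\<dots> = I v u - 2 * (of_real s * S v u)
      + of_real (s\<^sup>2) * (of_real (drackn_delta n r c) * S v u + of_real (real n - 1) * I v u)"
    unfolding I S by simp
  also have "\<dots> = of_real (1 + s\<^sup>2 * (real n - 1)) * I v u
      - of_real (2 * s - s\<^sup>2 * drackn_delta n r c) * S v u"
    by (simp add: algebra_simps)
  also have "1 + s\<^sup>2 * (real n - 1) = 1 - \<omega> / \<eta>"
  proof -
    have "real n - 1 = - (\<eta> * \<omega>)" using roots(2) by simp
    then show ?thesis using root_nonzero by (simp add: s_def power2_eq_square)
  qed
  also have "2 * s - s\<^sup>2 * drackn_delta n r c = (1 - \<omega> / \<eta>) * s"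
    unfolding roots(1)[symmetric] s_def using root_nonzero
    by (simp add: field_simps power2_eq_square)
  finally show ?thesis unfolding g by (simp add: algebra_simps)
qed

lemma real_gram_dimension:
  fixes x :: "'n \<Rightarrow> real^'k"
  assumes x: "\<And>u v. of_real (x u \<bullet> x v) = gram $ u $ v"
  shows "real n = (1 - \<omega> / \<eta>) * real (dim (range x))"
proof -
  have "(\<Sum>u\<in>UNIV. (x v \<bullet> x u) * (x u \<bullet> x w)) = (1 - \<omega> / \<eta>) * (x v \<bullet> x w)" for v w
  proof -
    have "of_real (\<Sum>u\<in>UNIV. (x v \<bullet> x u) * (x u \<bullet> x w)) = complex_of_real ((1 - \<omega> / \<eta>) * (x v \<bullet> x w))"
      using gram_square[of v w] unfolding x[symmetric] by simp
    then show ?thesis by (simp only: of_real_eq_iff)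
  qed
  from real_gram_dim[OF this]
  have "(\<Sum>u\<in>UNIV. x u \<bullet> x u) = (1 - \<omega> / \<eta>) * real (dim (range x))" .
  moreover have "x u \<bullet> x u = 1" for u
    using x[of u u] unfolding gram_diagonal by (simp only: of_real_eq_1_iff)
  ultimately show ?thesis by (simp add: card_n)
qed

lemma complex_gram_dimension:
  fixes x :: "'n \<Rightarrow> complex^'k"
  assumes x: "\<And>u v. cinner (x u) (x v) = gram $ u $ v"
  shows "real n = (1 - \<omega> / \<eta>) * real (vec.dim (range x))"
proof -
  have "(\<Sum>u\<in>UNIV. cinner (x v) (x u) * cinner (x u) (x w)) = of_real (1 - \<omega> / \<eta>) * cinner (x v) (x w)"
    for v w
    unfolding x by (rule gram_square)
  from complex_gram_dim[OF this]
  have "(\<Sum>u\<in>UNIV. Re (cinner (x u) (x u))) = (1 - \<omega> / \<eta>) * real (vec.dim (range x))" .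
  then show ?thesis unfolding x gram_diagonal by (simp add: card_n)
qed

text \<open>The rows of the Gram matrix, divided by the square root of the scale factor from
  \<open>gram_square\<close>, serve as vectors: a Hermitian matrix whose square is a multiple of
  itself is its own Gram factor up to scaling.\<close>

lemma exists_complex_lines:
  assumes pos: "0 < 1 - \<omega> / \<eta>"
  shows "\<exists>x :: 'n \<Rightarrow> complex^'n. \<forall>u v. cinner (x u) (x v) = gram $ u $ v"
proof -
  define s where "s = sqrt (1 - \<omega> / \<eta>)"
  have s: "s * s = 1 - \<omega> / \<eta>" using pos by (simp_all add: s_def)
  define x :: "'n \<Rightarrow> complex^'n" where "x u = (\<chi> w. gram $ u $ w / of_real s)" for u
  have "cinner (x u) (x v) = gram $ u $ v" for u v
  proof -
    have "cinner (x u) (x v) = (\<Sum>w\<in>UNIV. gram $ u $ w * gram $ w $ v) / of_real (s * s)"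
      unfolding cinner_def sum_divide_distrib x_def gram_adjoint[of _ v]
      by (intro sum.cong refl) simp
    moreover have nz: "complex_of_real (1 - \<omega> / \<eta>) \<noteq> 0"
      using pos by (simp only: of_real_eq_0_iff)
    ultimately show ?thesis
      unfolding gram_square s by (simp only: nonzero_mult_div_cancel_left[OF nz])
  qed
  then show ?thesis by blast
qed

lemma exists_real_lines:
  assumes real: "\<phi> ` carrier G \<subseteq> \<real>" and pos: "0 < 1 - \<omega> / \<eta>"
  shows "\<exists>x :: 'n \<Rightarrow> real^'n. \<forall>u v. of_real (x u \<bullet> x v) = gram $ u $ v"
proof -
  define s where "s = sqrt (1 - \<omega> / \<eta>)"
  have s: "s * s = 1 - \<omega> / \<eta>" using pos by (simp_all add: s_def)
  have "character_matrix f \<phi> $ u $ v \<in> \<real>" for u v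
    using real arc_in_G by (auto simp: character_matrix_def)
  then have Re: "of_real (Re (gram $ u $ v)) = gram $ u $ v" for u v
    unfolding gram_entry by (intro of_real_Re Reals_diff Reals_mult) auto
  \<comment> \<open>A Hermitian matrix with real entries is symmetric, so its scaled rows work
    without conjugation.\<close>
  then have sym: "gram $ u $ v = gram $ v $ u" for u v
    by (metis complex_cnj_complex_of_real gram_adjoint)
  define x :: "'n \<Rightarrow> real^'n" where "x u = (\<chi> w. Re (gram $ u $ w) / s)" for u
  have "of_real (x u \<bullet> x v) = gram $ u $ v" for u v
  proof -
    have "of_real (x u \<bullet> x v) = (\<Sum>w\<in>UNIV. gram $ u $ w * gram $ w $ v) / of_real (s * s)"
      unfolding inner_vec_def sum_divide_distrib x_def of_real_sum sym[of _ v]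
      by (intro sum.cong refl) (simp add: Re del: vector_minus_component)
    moreover have nz: "complex_of_real (1 - \<omega> / \<eta>) \<noteq> 0"
      using pos by (simp only: of_real_eq_0_iff)
    ultimately show ?thesis
      unfolding gram_square s by (simp only: nonzero_mult_div_cancel_left[OF nz])
  qed
  then show ?thesis by blast
qed

end

end

subsection \<open>Lines meeting the absolute bound\<close>

text \<open>A rational square root of a natural number is an integer: \<open>j\<^sup>2\<close>
  divides \<open>i\<^sup>2\<close>, hence \<open>j\<close> divides \<open>i\<close>.\<close>

lemma sqrt_nat_quotient_Nats:
  fixes x :: real
  assumes "x\<^sup>2 = real k" "x * of_int j = of_int i" "j \<noteq> 0"
  shows "\<bar>x\<bar> \<in> \<nat>"
proof -
  have "of_int (i\<^sup>2) = (of_int (int k * j\<^sup>2) :: real)"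
    using assms(1,2) by (simp add: power_mult_distrib flip: assms(2))
  then have "i\<^sup>2 = int k * j\<^sup>2" by (simp only: of_int_eq_iff)
  then have "j\<^sup>2 dvd i\<^sup>2" by simp
  then have "j dvd i" by (simp add: pow_divides_pow_iff)
  then obtain l where "i = j * l" by (rule dvdE)
  then have "x = of_int l" using assms(2,3) by simp
  then have "\<bar>x\<bar> = real (nat \<bar>l\<bar>)" by simp
  then show ?thesis by (simp only: of_nat_in_Nats)
qed

text \<open>Here \<open>d\<close> is the dimension of the lines, and \<open>n \<ge> 2\<close>
  excludes the values 0 and 1. Cancelling \<open>d\<close> in the dimension equation gives
  \<open>\<omega> = - \<eta> (d - 1) / 2\<close>; cancelling \<open>d - 1\<close> in the product
  relation gives \<open>\<eta>\<^sup>2 = d + 2\<close>. The sum relation reads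
  \<open>\<eta> (d - 3) = - 2 \<delta>\<close>, so \<eta> is rational unless \<open>d = 3\<close>,
  where \<open>\<eta>\<^sup>2 = 5\<close>.\<close>

lemma real_parameters:
  fixes \<eta> \<omega> :: real
  assumes n: "2 \<le> n" "real n = real d * (real d + 1) / 2"
    and roots: "\<eta> + \<omega> = of_int \<delta>" "\<eta> * \<omega> = 1 - real n"
    and dim: "real n * \<eta> = (\<eta> - \<omega>) * real d"
  shows "\<eta>\<^sup>2 = real d + 2" "\<omega> = - (\<eta> * (\<eta>\<^sup>2 - 3) / 2)" "\<bar>\<eta>\<bar> \<in> \<nat> \<or> \<bar>\<eta>\<bar> = sqrt 5"
proof -
  have d: "real d \<noteq> 0" "real d \<noteq> 1"
  proof -
    have "real d \<noteq> s" if "s = 0 \<or> s = 1" for s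
    proof
      assume "real d = s"
      then have "real n \<le> 1" using n(2) that by auto
      then show False using n(1) by simp
    qed
    then show "real d \<noteq> 0" "real d \<noteq> 1" by blast+
  qed
  have "real d * (\<omega> + \<eta> * (real d - 1) / 2) = 0"
    using dim unfolding n(2) by (simp add: field_simps)
  then have \<omega>: "\<omega> = - (\<eta> * (real d - 1) / 2)" using d by simp
  have "(real d - 1) * (\<eta>\<^sup>2 - (real d + 2)) = 0"
    using roots(2) unfolding \<omega> n(2) by Groebner_Basis.algebra
  then show sq: "\<eta>\<^sup>2 = real d + 2" using d by simp
  then show \<omega>': "\<omega> = - (\<eta> * (\<eta>\<^sup>2 - 3) / 2)" by (simp add: \<omega>)
  have *: "\<eta> * of_int (int d - 3) = of_int (- 2 * \<delta>)"
  proof -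
    have "\<eta> * (real d - 3) = - 2 * of_int \<delta>"
      unfolding roots(1)[symmetric] \<omega> by (simp add: field_simps)
    then show ?thesis by simp
  qed
  show "\<bar>\<eta>\<bar> \<in> \<nat> \<or> \<bar>\<eta>\<bar> = sqrt 5"
  proof (cases "d = 3")
    case True
    then have "\<eta>\<^sup>2 = 5" using sq by simp
    then have "sqrt 5 = \<bar>\<eta>\<bar>" using real_sqrt_abs[of \<eta>] by simp
    then show ?thesis by simp
  next
    case False
    then have "\<bar>\<eta>\<bar> \<in> \<nat>"
      using sqrt_nat_quotient_Nats[of \<eta> "d + 2" "int d - 3" "- 2 * \<delta>"] False
      by (simp only: sq *)
    then show ?thesis ..
  qed
qed

text \<open>The same elimination gives \<open>\<omega> = - \<eta> (d - 1)\<close>, then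
  \<open>\<eta>\<^sup>2 = d + 1\<close> and \<open>\<eta> (d - 2) = - \<delta>\<close>, with the
  exceptional dimension \<open>d = 2\<close>.\<close>

lemma complex_parameters:
  fixes \<eta> \<omega> :: real
  assumes n: "2 \<le> n" "real n = (real d)\<^sup>2"
    and roots: "\<eta> + \<omega> = of_int \<delta>" "\<eta> * \<omega> = 1 - real n"
    and dim: "real n * \<eta> = (\<eta> - \<omega>) * real d"
  shows "\<eta>\<^sup>2 = real d + 1" "\<omega> = - ((\<eta>\<^sup>2 - 2) * \<eta>)" "\<bar>\<eta>\<bar> \<in> \<nat> \<or> n = 4 \<and> \<delta> = 0"
proof -
  have d: "real d \<noteq> 0" "real d \<noteq> 1"
  proof -
    have "real d \<noteq> s" if "s = 0 \<or> s = 1" for s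
    proof
      assume "real d = s"
      then have "real n \<le> 1" using n(2) that by auto
      then show False using n(1) by simp
    qed
    then show "real d \<noteq> 0" "real d \<noteq> 1" by blast+
  qed
  have "real d * (\<omega> + \<eta> * (real d - 1)) = 0"
    using dim n(2) by Groebner_Basis.algebra
  then have \<omega>: "\<omega> = - (\<eta> * (real d - 1))" using d by simp
  have "(real d - 1) * (\<eta>\<^sup>2 - (real d + 1)) = 0"
    using roots(2) unfolding \<omega> n(2) by Groebner_Basis.algebra
  then show sq: "\<eta>\<^sup>2 = real d + 1" using d by simp
  then show \<omega>': "\<omega> = - ((\<eta>\<^sup>2 - 2) * \<eta>)" by (simp add: \<omega>)
  have *: "\<eta> * of_int (int d - 2) = of_int (- \<delta>)"
    using roots(1) \<omega> by (simp add: algebra_simps)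
  show "\<bar>\<eta>\<bar> \<in> \<nat> \<or> n = 4 \<and> \<delta> = 0"
  proof (cases "d = 2")
    case True
    then have "real n = 4" "real_of_int \<delta> = 0" using n(2) * by simp_all
    then show ?thesis by simp
  next
    case False
    then have "\<bar>\<eta>\<bar> \<in> \<nat>"
      using sqrt_nat_quotient_Nats[of \<eta> "d + 1" "int d - 2" "- \<delta>"] False
      by (simp only: sq *)
    then show ?thesis ..
  qed
qed

section \<open>The absolute bound as a pair of equations for the roots\<close>

lemma dimension_equation:
  fixes \<eta> \<omega> :: real
  assumes "\<eta> \<noteq> 0"
  shows "real n = (1 - \<omega> / \<eta>) * real d \<longleftrightarrow> real n * \<eta> = (\<eta> - \<omega>) * real d"
  using assms by (simp add: field_simps)

lemma drackn_delta_int: "drackn_delta n r c = of_int (int n - int r * int c - 2)"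
  by (simp add: drackn_delta_def)

lemma positive_scale:
  fixes \<eta> \<omega> :: real
  assumes "0 < n" "real n = (1 - \<omega> / \<eta>) * real d"
  shows "0 < 1 - \<omega> / \<eta>"
proof -
  have "0 < (1 - \<omega> / \<eta>) * real d" using assms by simp
  then show ?thesis by (simp add: zero_less_mult_iff)
qed

lemma drackn_conjugate_roots:
  assumes "drackn n r c E p"
    and "{\<eta>, \<omega>} = {drackn_theta n r c, drackn_tau n r c}"
  shows "\<eta> + \<omega> = drackn_delta n r c" "\<eta> * \<omega> = 1 - real n"
  using assms(2) drackn_eigenvalues(1,2)[OF assms(1)]
  by (auto simp: doubleton_eq_iff add.commute mult.commute)

text \<open>The roots determine the dimension of the lines, whatever presentation, character and
  realization are taken. Conversely, even \<open>r\<close> provides a real-valued character, and the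
  scaled rows of its Gram matrix realize the lines.\<close>

lemma gives_real_lines_iff:
  fixes p :: "'v::finite \<Rightarrow> 'n::finite"
  assumes X: "abelian_drackn n r c E p" and r: "even r"
  shows "gives_real_lines_meeting_absolute_bound n r c E p \<longleftrightarrow>
    (\<exists>\<eta> \<omega> d. {\<eta>, \<omega>} = {drackn_theta n r c, drackn_tau n r c} \<and>
      real n = real d * (real d + 1) / 2 \<and> real n * \<eta> = (\<eta> - \<omega>) * real d)" (is "?L \<longleftrightarrow> ?R")
proof
  have dr: "drackn n r c E p" using X by (simp add: abelian_drackn_def)
  assume ?L
  then obtain f \<phi> \<eta> and x :: "'n \<Rightarrow> real^'n" where pres: "abelian_presentation E p r f"
    and \<phi>: "nontrivial_character (arc_group r f) \<phi>"
    and \<eta>: "\<eta> \<in> {drackn_theta n r c, drackn_tau n r c}"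
    and x: "\<And>u v. of_real (x u \<bullet> x v) = (mat 1 - (1 / \<eta>) *\<^sub>R character_matrix f \<phi>) $ u $ v"
    and meets: "meets_real_absolute_bound x"
    unfolding gives_real_lines_meeting_absolute_bound_def by blast
  interpret presented_drackn n r c E p f
    using dr pres by unfold_locales
  obtain \<omega> where \<omega>: "{\<eta>, \<omega>} = {drackn_theta n r c, drackn_tau n r c}"
    using \<eta> by blast
  note roots = drackn_conjugate_roots[OF dr \<omega>]
  have "real n * \<eta> = (\<eta> - \<omega>) * real (dim (range x))"
    using real_gram_dimension[OF \<phi> roots x] dimension_equation[OF root_nonzero[OF \<phi> roots]]
    by blast
  moreover have "n = (dim (range x) + 1) choose 2"
    using meets card_n by (simp add: meets_real_absolute_bound_def)
  then have "real n = real (dim (range x)) * (real (dim (range x)) + 1) / 2"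
    using real_choose_two by metis
  ultimately show ?R using \<omega> by blast
next
  have dr: "drackn n r c E p" using X by (simp add: abelian_drackn_def)
  assume ?R
  then obtain \<eta> \<omega> d where \<omega>: "{\<eta>, \<omega>} = {drackn_theta n r c, drackn_tau n r c}"
    and n: "real n = real d * (real d + 1) / 2" and dim: "real n * \<eta> = (\<eta> - \<omega>) * real d"
    by blast
  obtain f where pres: "abelian_presentation E p r f"
    using X by (auto simp: abelian_drackn_def)
  interpret presented_drackn n r c E p f
    using dr pres by unfold_locales
  obtain \<phi> where \<phi>: "nontrivial_character G \<phi>" "\<phi> ` carrier G \<subseteq> \<real>"
    using exists_real_nontrivial_character[OF comm_group_G finite_G] card_G r by metis
  note roots = drackn_conjugate_roots[OF dr \<omega>]
  note \<eta>0 = root_nonzero[OF \<phi>(1) roots]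
  have dim': "real n = (1 - \<omega> / \<eta>) * real d"
    using dim dimension_equation[OF \<eta>0] by blast
  have pos: "0 < 1 - \<omega> / \<eta>"
    using positive_scale[OF _ dim'] n_ge_2 by simp
  obtain x :: "'n \<Rightarrow> real^'n"
    where x: "\<And>u v. of_real (x u \<bullet> x v) = (mat 1 - (1 / \<eta>) *\<^sub>R character_matrix f \<phi>) $ u $ v"
    using exists_real_lines[OF \<phi>(1) roots \<phi>(2) pos] by blast
  have "(1 - \<omega> / \<eta>) * real (dim (range x)) = (1 - \<omega> / \<eta>) * real d"
    by (rule trans[OF real_gram_dimension[OF \<phi>(1) roots x, symmetric] dim'])
  then have "real (dim (range x)) = real d"
    using pos unfolding mult_cancel_left by linarith
  then have "dim (range x) = d" by (simp only: of_nat_eq_iff)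
  moreover have "real CARD('n) = real ((d + 1) choose 2)"
    using n unfolding card_n real_choose_two .
  then have "CARD('n) = (d + 1) choose 2" by (simp only: of_nat_eq_iff)
  moreover have "real_equiangular x"
    unfolding real_equiangular_def
  proof (intro conjI allI exI impI)
    show "x u \<bullet> x u = 1" for u
      using x[of u u] unfolding gram_diagonal[OF \<phi>(1) roots] by (simp only: of_real_eq_1_iff)
    \<comment> \<open>The lines are distinct because \<open>\<bar>\<eta>\<bar>\<close> exceeds 1, so
      that the common cosine is below 1.\<close>
    have "\<eta>\<^sup>2 = real d + 2"
      using real_parameters(1)[OF n_ge_2 n roots(1)[unfolded drackn_delta_int] roots(2) dim] .
    then have "1\<^sup>2 < \<bar>\<eta>\<bar>\<^sup>2" by simp
    then have "1 < \<bar>\<eta>\<bar>" by (rule power_less_imp_less_base) simp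
    then show "1 / \<bar>\<eta>\<bar> < 1" by simp
    show "\<bar>x u \<bullet> x v\<bar> = 1 / \<bar>\<eta>\<bar>" if "u \<noteq> v" for u v
      using cmod_gram[OF \<phi>(1) roots that] unfolding x[symmetric] by simp
  qed
  ultimately have "meets_real_absolute_bound x"
    by (simp add: meets_real_absolute_bound_def)
  moreover have "\<eta> \<in> {drackn_theta n r c, drackn_tau n r c}" using \<omega> by blast
  ultimately show ?L
    unfolding gives_real_lines_meeting_absolute_bound_def using pres \<phi> x by blast
qed

text \<open>As in the real case, now with an arbitrary non-trivial character, which exists because
  the group has order \<open>r \<ge> 2\<close>.\<close>

lemma gives_complex_lines_iff:
  fixes p :: "'v::finite \<Rightarrow> 'n::finite"
  assumes X: "abelian_drackn n r c E p"
  shows "gives_complex_lines_meeting_absolute_bound n r c E p \<longleftrightarrow>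
    (\<exists>\<eta> \<omega> d. {\<eta>, \<omega>} = {drackn_theta n r c, drackn_tau n r c} \<and>
      real n = (real d)\<^sup>2 \<and> real n * \<eta> = (\<eta> - \<omega>) * real d)" (is "?L \<longleftrightarrow> ?R")
proof
  have dr: "drackn n r c E p" using X by (simp add: abelian_drackn_def)
  assume ?L
  then obtain f \<phi> \<eta> and x :: "'n \<Rightarrow> complex^'n" where pres: "abelian_presentation E p r f"
    and \<phi>: "nontrivial_character (arc_group r f) \<phi>"
    and \<eta>: "\<eta> \<in> {drackn_theta n r c, drackn_tau n r c}"
    and x: "\<And>u v. cinner (x u) (x v) = (mat 1 - (1 / \<eta>) *\<^sub>R character_matrix f \<phi>) $ u $ v"
    and meets: "meets_complex_absolute_bound x"
    unfolding gives_complex_lines_meeting_absolute_bound_def by blast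
  interpret presented_drackn n r c E p f
    using dr pres by unfold_locales
  obtain \<omega> where \<omega>: "{\<eta>, \<omega>} = {drackn_theta n r c, drackn_tau n r c}"
    using \<eta> by blast
  note roots = drackn_conjugate_roots[OF dr \<omega>]
  have "real n * \<eta> = (\<eta> - \<omega>) * real (vec.dim (range x))"
    using complex_gram_dimension[OF \<phi> roots x] dimension_equation[OF root_nonzero[OF \<phi> roots]]
    by blast
  moreover have "real n = (real (vec.dim (range x)))\<^sup>2"
    using meets card_n by (simp add: meets_complex_absolute_bound_def)
  ultimately show ?R using \<omega> by blast
next
  have dr: "drackn n r c E p" using X by (simp add: abelian_drackn_def)
  assume ?R
  then obtain \<eta> \<omega> d where \<omega>: "{\<eta>, \<omega>} = {drackn_theta n r c, drackn_tau n r c}"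
    and n: "real n = (real d)\<^sup>2" and dim: "real n * \<eta> = (\<eta> - \<omega>) * real d"
    by blast
  obtain f where pres: "abelian_presentation E p r f"
    using X by (auto simp: abelian_drackn_def)
  interpret presented_drackn n r c E p f
    using dr pres by unfold_locales
  have "card (carrier G) \<noteq> 1" using card_G r_ge_2 by simp
  then obtain \<phi> where \<phi>: "nontrivial_character G \<phi>"
    using exists_nontrivial_character[OF comm_group_G finite_G] by blast
  note roots = drackn_conjugate_roots[OF dr \<omega>]
  note \<eta>0 = root_nonzero[OF \<phi> roots]
  have dim': "real n = (1 - \<omega> / \<eta>) * real d"
    using dim dimension_equation[OF \<eta>0] by blast
  have pos: "0 < 1 - \<omega> / \<eta>"
    using positive_scale[OF _ dim'] n_ge_2 by simp
  obtain x :: "'n \<Rightarrow> complex^'n"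
    where x: "\<And>u v. cinner (x u) (x v) = (mat 1 - (1 / \<eta>) *\<^sub>R character_matrix f \<phi>) $ u $ v"
    using exists_complex_lines[OF \<phi> roots pos] by blast
  have "(1 - \<omega> / \<eta>) * real (vec.dim (range x)) = (1 - \<omega> / \<eta>) * real d"
    by (rule trans[OF complex_gram_dimension[OF \<phi> roots x, symmetric] dim'])
  then have "real (vec.dim (range x)) = real d"
    using pos unfolding mult_cancel_left by linarith
  then have "vec.dim (range x) = d" by (simp only: of_nat_eq_iff)
  moreover have "real CARD('n) = real (d\<^sup>2)"
    using n unfolding card_n by simp
  then have "CARD('n) = d\<^sup>2" by (simp only: of_nat_eq_iff)
  moreover have "complex_equiangular x"
    unfolding complex_equiangular_def
  proof (intro conjI allI exI impI)
    show "cinner (x u) (x u) = 1" for u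
      unfolding x by (rule gram_diagonal[OF \<phi> roots])
    have "\<eta>\<^sup>2 = real d + 1"
      using complex_parameters(1)[OF n_ge_2 n roots(1)[unfolded drackn_delta_int] roots(2) dim] .
    moreover have "d \<noteq> 0" using n n_ge_2 by (intro notI) simp
    ultimately have "1\<^sup>2 < \<bar>\<eta>\<bar>\<^sup>2" by simp
    then have "1 < \<bar>\<eta>\<bar>" by (rule power_less_imp_less_base) simp
    then show "1 / \<bar>\<eta>\<bar> < 1" by simp
    show "cmod (cinner (x u) (x v)) = 1 / \<bar>\<eta>\<bar>" if "u \<noteq> v" for u v
      unfolding x by (rule cmod_gram[OF \<phi> roots that])
  qed
  ultimately have "meets_complex_absolute_bound x"
    by (simp add: meets_complex_absolute_bound_def)
  moreover have "\<eta> \<in> {drackn_theta n r c, drackn_tau n r c}" using \<omega> by blast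
  ultimately show ?L
    unfolding gives_complex_lines_meeting_absolute_bound_def using pres \<phi> x by blast
qed

text \<open>Substituting \<open>d = \<eta>\<^sup>2 - 2\<close> turns every parameter into a
  polynomial in \<eta>. In the application \<open>d\<close> is the reduced multiplicity of \<omega>,
  and \<open>n - d\<close> that of \<eta>.\<close>

lemma real_case_parameters:
  fixes \<eta> \<omega> :: real
  assumes "\<eta>\<^sup>2 = d + 2" "\<omega> = - (\<eta> * (\<eta>\<^sup>2 - 3) / 2)" "n = d * (d + 1) / 2" "n - rc - 2 = \<eta> + \<omega>"
  shows "n = (\<eta>\<^sup>2 - 2) * (\<eta>\<^sup>2 - 1) / 2" "rc = (\<eta> + 1) ^ 3 * (\<eta> - 2) / 2"
    "\<eta> + \<omega> = - (\<eta> * (\<eta>\<^sup>2 - 5) / 2)" "n - d = (\<eta>\<^sup>2 - 2) * (\<eta>\<^sup>2 - 3) / 2"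
proof -
  have d: "d = \<eta>\<^sup>2 - 2" using assms(1) by simp
  show n: "n = (\<eta>\<^sup>2 - 2) * (\<eta>\<^sup>2 - 1) / 2" unfolding assms(3) d by simp
  show sum: "\<eta> + \<omega> = - (\<eta> * (\<eta>\<^sup>2 - 5) / 2)" unfolding assms(2) by (simp add: field_simps)
  have "rc = n - 2 - (\<eta> + \<omega>)" using assms(4) by simp
  then show "rc = (\<eta> + 1) ^ 3 * (\<eta> - 2) / 2"
    unfolding sum n by (simp add: field_simps power2_eq_square power3_eq_cube)
  show "n - d = (\<eta>\<^sup>2 - 2) * (\<eta>\<^sup>2 - 3) / 2"
    unfolding n d by (simp add: field_simps)
qed

lemma complex_case_parameters:
  fixes \<eta> \<omega> :: real
  assumes "\<eta>\<^sup>2 = d + 1" "\<omega> = - ((\<eta>\<^sup>2 - 2) * \<eta>)" "n = d\<^sup>2" "n - rc - 2 = \<eta> + \<omega>"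
  shows "n = (\<eta>\<^sup>2 - 1)\<^sup>2" "rc = (\<eta> + 1)\<^sup>2 * (\<eta>\<^sup>2 - \<eta> - 1)"
    "\<eta> + \<omega> = - ((\<eta>\<^sup>2 - 3) * \<eta>)" "n - d = (\<eta>\<^sup>2 - 2) * (\<eta>\<^sup>2 - 1)"
proof -
  have d: "d = \<eta>\<^sup>2 - 1" using assms(1) by simp
  show n: "n = (\<eta>\<^sup>2 - 1)\<^sup>2" unfolding assms(3) d by simp
  show sum: "\<eta> + \<omega> = - ((\<eta>\<^sup>2 - 3) * \<eta>)" unfolding assms(2) by (simp add: algebra_simps)
  have "rc = n - 2 - (\<eta> + \<omega>)" using assms(4) by simp
  then show "rc = (\<eta> + 1)\<^sup>2 * (\<eta>\<^sup>2 - \<eta> - 1)"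
    unfolding sum n by (simp add: algebra_simps power2_eq_square)
  show "n - d = (\<eta>\<^sup>2 - 2) * (\<eta>\<^sup>2 - 1)"
    unfolding n d by (simp add: algebra_simps power2_eq_square)
qed

theorem theorem6p5:
  fixes n r c :: nat
    and E :: "'v::finite \<Rightarrow> 'v \<Rightarrow> bool" and p :: "'v \<Rightarrow> 'n::finite"
    and \<delta> \<theta> \<tau> M\<theta> M\<tau> :: real
  assumes X: "abelian_drackn n r c E p"
    and delta: "\<delta> = drackn_delta n r c"
    and theta: "\<theta> = drackn_theta n r c"
    and tau: "\<tau> = drackn_tau n r c"
    and M_theta: "M\<theta> = real (eigenvalue_multiplicity E \<theta>) / (real r - 1)"
    and M_tau: "M\<tau> = real (eigenvalue_multiplicity E \<tau>) / (real r - 1)"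
  shows
    "(even r \<longrightarrow>
       (gives_real_lines_meeting_absolute_bound n r c E p \<longleftrightarrow>
        (\<exists>t::real. ((\<exists>k::nat. k > 0 \<and> t = real k) \<or> t = sqrt 5) \<and>
          ((real n = (t^2 - 2) * (t^2 - 1) / 2 \<and>
            real r * real c = (t + 1)^3 * (t - 2) / 2 \<and>
            \<delta> = - (t * (t^2 - 5) / 2) \<and>
            \<theta> = t \<and>
            \<tau> = - (t * (t^2 - 3) / 2) \<and>
            M\<theta> = (t^2 - 2) * (t^2 - 3) / 2 \<and>
            M\<tau> = t^2 - 2) \<or>
           (real n = (t^2 - 2) * (t^2 - 1) / 2 \<and>
            real r * real c = (t - 1)^3 * (t + 2) / 2 \<and>
            \<delta> = t * (t^2 - 5) / 2 \<and>
            \<theta> = t * (t^2 - 3) / 2 \<and>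
            \<tau> = - t \<and>
            M\<theta> = t^2 - 2 \<and>
            M\<tau> = (t^2 - 2) * (t^2 - 3) / 2))))) \<and>
     (odd r \<longrightarrow>
       (gives_complex_lines_meeting_absolute_bound n r c E p \<longleftrightarrow>
        (\<exists>t::real. (\<exists>k::nat. k > 0 \<and> t = real k) \<and>
          ((real n = (t^2 - 1)^2 \<and>
            real r * real c = (t + 1)^2 * (t^2 - t - 1) \<and>
            \<delta> = - ((t^2 - 3) * t) \<and>
            \<theta> = t \<and>
            \<tau> = - ((t^2 - 2) * t) \<and>
            M\<theta> = (t^2 - 2) * (t^2 - 1) \<and>
            M\<tau> = t^2 - 1) \<or>
           (real n = (t^2 - 1)^2 \<and>
            real r * real c = (t - 1)^2 * (t^2 + t - 1) \<and>
            \<delta> = (t^2 - 3) * t \<and>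
            \<theta> = (t^2 - 2) * t \<and>
            \<tau> = - t \<and>
            M\<theta> = t^2 - 1 \<and>
            M\<tau> = (t^2 - 2) * (t^2 - 1))))))"
proof -
  have dr: "drackn n r c E p" using X by (simp add: abelian_drackn_def)
  have n2: "2 \<le> n" and r2: "2 \<le> r" using dr by (simp_all add: drackn_def)
  note ev = drackn_eigenvalues[OF dr, folded delta theta tau]
  note conj = drackn_conjugate_roots[OF dr, folded delta theta tau]
  note mult = drackn_reduced_multiplicities[OF dr, folded theta tau, folded M_theta M_tau]
  have \<delta>: "\<delta> = of_int (int n - int r * int c - 2)"
    unfolding delta by (rule drackn_delta_int)
  have cases: "\<eta> = \<theta> \<and> \<omega> = \<tau> \<or> \<eta> = \<tau> \<and> \<omega> = \<theta>" if "{\<eta>, \<omega>} = {\<theta>, \<tau>}" for \<eta> \<omega>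
    using that by (auto simp: doubleton_eq_iff)
  have pos: "0 < \<theta> - \<tau>" using ev(3,4) by simp
  \<comment> \<open>Positivity of the reduced multiplicities ensures in the converse directions that
    the natural subtractions \<open>m - 2\<close> and \<open>m - 1\<close> are not
    truncated.\<close>
  have M_pos: "0 < M\<theta>" "0 < M\<tau>"
  proof -
    have "0 < (\<theta> - \<tau>) * M\<theta>" "0 < (\<theta> - \<tau>) * M\<tau>"
      unfolding mult using ev(3,4) n2 by (simp_all add: mult_pos_pos mult_neg_pos)
    then show "0 < M\<theta>" "0 < M\<tau>" using pos by (simp_all add: zero_less_mult_iff)
  qed
  have M_theta_eq: "M\<theta> = m" if "(\<theta> - \<tau>) * m = - \<tau> * real n" for m
    using that pos unfolding mult(1)[symmetric] mult_cancel_left by linarith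
  have M_tau_eq: "M\<tau> = m" if "(\<theta> - \<tau>) * m = \<theta> * real n" for m
    using that pos unfolding mult(2)[symmetric] mult_cancel_left by linarith
  \<comment> \<open>The lines built from one root have as dimension the reduced multiplicity of the
    other, and the two reduced multiplicities add up to \<open>n\<close>.\<close>
  have M1: "M\<tau> = d \<and> M\<theta> = real n - d" if "real n * \<theta> = (\<theta> - \<tau>) * d" for d
    using that by (intro conjI M_theta_eq M_tau_eq) (simp_all add: algebra_simps)
  have M2: "M\<theta> = d \<and> M\<tau> = real n - d" if "real n * \<tau> = (\<tau> - \<theta>) * d" for d
    using that by (intro conjI M_theta_eq M_tau_eq) (simp_all add: algebra_simps)
  show ?thesis
  proof (intro conjI impI, goal_cases)
    case 1
    show ?case (is "?L \<longleftrightarrow> (\<exists>t. ?T t \<and> (?A t \<or> ?B t))")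
    proof
      assume ?L
      then obtain \<eta> \<omega> d where \<eta>\<omega>: "{\<eta>, \<omega>} = {\<theta>, \<tau>}"
        and n: "real n = real d * (real d + 1) / 2" and dim: "real n * \<eta> = (\<eta> - \<omega>) * real d"
        using gives_real_lines_iff[OF X 1, folded theta tau] by blast
      note par = real_parameters[OF n2 n conj(1)[OF \<eta>\<omega>, unfolded \<delta>] conj(2)[OF \<eta>\<omega>] dim]
      have "real n - real r * real c - 2 = \<eta> + \<omega>"
        unfolding conj(1)[OF \<eta>\<omega>] delta drackn_delta_def ..
      note val = real_case_parameters[OF par(1,2) n this]
      have T: "?T \<bar>\<eta>\<bar>"
        using par(3) ev(3,4) cases[OF \<eta>\<omega>] by (auto elim!: Nats_cases)
      show "\<exists>t. ?T t \<and> (?A t \<or> ?B t)"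
        using cases[OF \<eta>\<omega>]
      proof
        assume "\<eta> = \<theta> \<and> \<omega> = \<tau>"
        then have e: "\<eta> = \<theta>" "\<omega> = \<tau>" by simp_all
        have "?A \<theta>"
          using val par(1,2) M1[OF dim[unfolded e]] ev(1) unfolding e by auto
        moreover have "?T \<theta>" using T ev(3) unfolding e by simp
        ultimately show ?thesis by blast
      next
        assume "\<eta> = \<tau> \<and> \<omega> = \<theta>"
        then have e: "\<eta> = \<tau>" "\<omega> = \<theta>" by simp_all
        \<comment> \<open>In the second case \<open>t = - \<eta>\<close>; the sign changes of the
          cubed and the linear factor of \<open>rc\<close> cancel.\<close>
        have "(1 - t) ^ 3 * (- t - 2) = (t - 1) ^ 3 * (t + 2)" for t :: real
          by (simp add: algebra_simps power3_eq_cube)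
        from this[of "- \<tau>"] have "(\<tau> + 1) ^ 3 * (\<tau> - 2) = (- \<tau> - 1) ^ 3 * (- \<tau> + 2)"
          by (simp add: add.commute)
        then have "?B (- \<tau>)"
          using val par(1,2) M2[OF dim[unfolded e]] ev(1) unfolding e by auto
        moreover have "?T (- \<tau>)" using T ev(4) unfolding e by simp
        ultimately show ?thesis by blast
      qed
    next
      assume "\<exists>t. ?T t \<and> (?A t \<or> ?B t)"
      then obtain t where T: "?T t" and AB: "?A t \<or> ?B t" by blast
      \<comment> \<open>In both alternatives \<open>t\<^sup>2\<close> is a natural number, so
        \<open>t\<^sup>2 - 2\<close> can serve as the dimension \<open>d\<close>.\<close>
      from T obtain m where m: "t\<^sup>2 = real m"
      proof
        assume "\<exists>k::nat. k > 0 \<and> t = real k"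
        then obtain k where "t = real k" by blast
        then have "t\<^sup>2 = real (k\<^sup>2)" by simp
        then show ?thesis by (rule that)
      next
        assume "t = sqrt 5"
        then have "t\<^sup>2 = real 5" by simp
        then show ?thesis by (rule that)
      qed
      have "0 < t\<^sup>2 - 2" using AB M_pos by auto
      then have d: "real (m - 2) = t\<^sup>2 - 2" using m by (simp add: of_nat_diff)
      have n: "real n = real (m - 2) * (real (m - 2) + 1) / 2"
        unfolding d using AB by auto
      \<comment> \<open>The root \<eta> is the one whose conjugate has reduced multiplicity
        \<open>t\<^sup>2 - 2\<close>: \<theta> in the first case, \<tau> in the second.\<close>
      have "\<exists>\<eta> \<omega>. {\<eta>, \<omega>} = {\<theta>, \<tau>} \<and> real n * \<eta> = (\<eta> - \<omega>) * real (m - 2)"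
        using AB
      proof
        assume "?A t"
        then have "M\<tau> = real (m - 2)" unfolding d by blast
        then have "real n * \<theta> = (\<theta> - \<tau>) * real (m - 2)" using mult(2) by simp
        then show ?thesis by blast
      next
        assume "?B t"
        then have "M\<theta> = real (m - 2)" unfolding d by blast
        then have "real n * \<tau> = (\<tau> - \<theta>) * real (m - 2)" using mult(1) by (simp add: algebra_simps)
        then show ?thesis by blast
      qed
      then show ?L
        using gives_real_lines_iff[OF X 1, folded theta tau] n by blast
    qed
  next
    case 2
    show ?case (is "?L \<longleftrightarrow> (\<exists>t. ?T t \<and> (?A t \<or> ?B t))")
    proof
      assume ?L
      then obtain \<eta> \<omega> d where \<eta>\<omega>: "{\<eta>, \<omega>} = {\<theta>, \<tau>}"
        and n: "real n = (real d)\<^sup>2" and dim: "real n * \<eta> = (\<eta> - \<omega>) * real d"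
        using gives_complex_lines_iff[OF X, folded theta tau] by blast
      note par = complex_parameters[OF n2 n conj(1)[OF \<eta>\<omega>, unfolded \<delta>] conj(2)[OF \<eta>\<omega>] dim]
      have "real n - real r * real c - 2 = \<eta> + \<omega>"
        unfolding conj(1)[OF \<eta>\<omega>] delta drackn_delta_def ..
      note val = complex_case_parameters[OF par(1,2) n this]
      \<comment> \<open>The exceptional solution has \<open>rc = 2\<close>, which forces
        \<open>r = 2\<close> and contradicts odd \<open>r\<close>.\<close>
      have "\<not> (n = 4 \<and> int n - int r * int c - 2 = 0)"
      proof
        assume "n = 4 \<and> int n - int r * int c - 2 = 0"
        then have "int (r * c) = int 2" by simp
        then have "r * c = 2" by (simp only: of_nat_eq_iff)
        then have "r dvd 2" by (metis dvd_triv_left)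
        then have "r \<le> 2" by (rule dvd_imp_le) simp
        then show False using r2 2 by simp
      qed
      then have T: "?T \<bar>\<eta>\<bar>"
        using par(3) ev(3,4) cases[OF \<eta>\<omega>] by (auto elim!: Nats_cases)
      show "\<exists>t. ?T t \<and> (?A t \<or> ?B t)"
        using cases[OF \<eta>\<omega>]
      proof
        assume "\<eta> = \<theta> \<and> \<omega> = \<tau>"
        then have e: "\<eta> = \<theta>" "\<omega> = \<tau>" by simp_all
        have "?A \<theta>"
          using val par(1,2) M1[OF dim[unfolded e]] ev(1) unfolding e by auto
        moreover have "?T \<theta>" using T ev(3) unfolding e by simp
        ultimately show ?thesis by blast
      next
        assume "\<eta> = \<tau> \<and> \<omega> = \<theta>"
        then have e: "\<eta> = \<tau>" "\<omega> = \<theta>" by simp_all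
        have "(\<tau> + 1)\<^sup>2 = (- \<tau> - 1)\<^sup>2"
          by (simp add: power2_eq_square algebra_simps)
        then have "?B (- \<tau>)"
          using val par(1,2) M2[OF dim[unfolded e]] ev(1) unfolding e by auto
        moreover have "?T (- \<tau>)" using T ev(4) unfolding e by simp
        ultimately show ?thesis by blast
      qed
    next
      assume "\<exists>t. ?T t \<and> (?A t \<or> ?B t)"
      then obtain t where T: "?T t" and AB: "?A t \<or> ?B t" by blast
      then obtain k where "t = real k" by blast
      then have "t\<^sup>2 = real (k\<^sup>2)" by simp
      then obtain m where m: "t\<^sup>2 = real m" by blast
      \<comment> \<open>The dimension is now \<open>t\<^sup>2 - 1\<close>, positive as one of the
        reduced multiplicities.\<close>
      have "0 < t\<^sup>2 - 1" using AB M_pos by auto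
      then have d: "real (m - 1) = t\<^sup>2 - 1" using m by (simp add: of_nat_diff)
      have n: "real n = (real (m - 1))\<^sup>2"
        unfolding d using AB by auto
      have "\<exists>\<eta> \<omega>. {\<eta>, \<omega>} = {\<theta>, \<tau>} \<and> real n * \<eta> = (\<eta> - \<omega>) * real (m - 1)"
        using AB
      proof
        assume "?A t"
        then have "M\<tau> = real (m - 1)" unfolding d by blast
        then have "real n * \<theta> = (\<theta> - \<tau>) * real (m - 1)" using mult(2) by simp
        then show ?thesis by blast
      next
        assume "?B t"
        then have "M\<theta> = real (m - 1)" unfolding d by blast
        then have "real n * \<tau> = (\<tau> - \<theta>) * real (m - 1)" using mult(1) by (simp add: algebra_simps)
        then show ?thesis by blast
      qed
      then show ?L
        using gives_complex_lines_iff[OF X, folded theta tau] n by blast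
    qed
  qed
qed

end
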